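(* Let $(M,g)$ be a semi-Riemannian locally symmetric space and let $R_{ijkl}$ be the components of the curvature tensor of its Levi-Civita connection. Then, at each point $p\in M$, the element $$\hat r(\lambda_1,\lambda_2) := \frac{1}{\lambda_1-\lambda_2}\sum_{i,j,k,l} R^{i}{}_{j}{}^{k}{}_{l}\; E_i^{\;j}\otimes E_k^{\;l}\;\in\; \mathrm{End}(T_pM)\otimes \mathrm{End}(T_pM)\otimes\mathbb{C}(\lambda_1,\lambda_2)$$ is a rational solution of the classical Yang-Baxter equation with spectral parameters, i.e. $$[\hat r_{12}(\lambda_1,\lambda_2),\hat r_{13}(\lambda_1,\lambda_3)]+[\hat r_{12}(\lambda_1,\lambda_2),\hat r_{23}(\lambda_2,\lambda_3)]+[\hat r_{13}(\lambda_1,\lambda_3),\hat r_{23}(\lambda_2,\lambda_3)]=0$$ in $\mathrm{End}(T_pM)^{\otimes 3}\otimes\mathbb{C}(\lambda_1,\lambda_2,\lambda_3)$.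
   Context: A semi-Riemannian manifold $(M,g)$ is called locally symmetric if around every point the geodesic symmetry ($x\mapsto -x$ in an exponential chart) is a local isometry; equivalently, the curvature tensor $R$ of the Levi-Civita connection $\nabla$ satisfies $\nabla R=0$. In local coordinates the curvature components are defined by $R_{klm}{}^{i}\frac{\partial}{\partial x^i}:=R\left(\frac{\partial}{\partial x^k},\frac{\partial}{\partial x^l}\right)\frac{\partial}{\partial x^m}$, where $R(X,Y)=\nabla^2_{XY}-\nabla^2_{YX}$ on vector fields and $\nabla^2_{XY}=\nabla_X\nabla_Y-\nabla_{\nabla_XY}$. Indices are lowered and raised with the metric: $R_{ijkl}$ is obtained from $R_{ijk}{}^{m}$ by lowering the last index, and $R^{i}{}_{j}{}^{k}{}_{l}$ is obtained from $R_{ijkl}$ by raising the first and third indices. $E_i^{\;j}\in\mathrm{End}(T_pM)$ is the elementary endomorphism with $E_i^{\;j}\left(\frac{\partial}{\partial x^k}\right)=\delta^j_k\frac{\partial}{\partial x^i}$. Subscripts on $\hat r$ indicate on which factors of the threefold tensor product it acts (e.g. $\hat r_{13}$ acts on the first and third factors, as the identity on the second). *)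

theory Defs
  imports "HOL-Analysis.Analysis" "HOL-Computational_Algebra.Fraction_Field"
begin

subsection \<open>Smooth maps between open subsets of Euclidean spaces\<close>

primrec Ck_on :: "nat \<Rightarrow> 'a::real_normed_vector set \<Rightarrow> ('a \<Rightarrow> 'b::real_normed_vector) \<Rightarrow> bool" where
  "Ck_on 0 S f \<longleftrightarrow> continuous_on S f"
| "Ck_on (Suc k) S f \<longleftrightarrow> (\<forall>x\<in>S. f differentiable (at x)) \<and>
     (\<forall>v. Ck_on k S (\<lambda>x. frechet_derivative f (at x) v))"

text \<open>Only meaningful (and only used) for open \<open>S\<close>.\<close>

definition smooth_on :: "'a::real_normed_vector set \<Rightarrow> ('a \<Rightarrow> 'b::real_normed_vector) \<Rightarrow> bool" where
  "smooth_on S f \<longleftrightarrow> (\<forall>k. Ck_on k S f)"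


subsection \<open>Smooth manifolds\<close>

text \<open>A manifold is a type \<open>'m\<close> (Hausdorff, second countable) together with a maximal smooth atlas.
  A chart is a pair of its domain and its coordinate map; the values of the coordinate map outside
  the domain are irrelevant.\<close>

type_synonym ('m, 'n) chart = "'m set \<times> ('m \<Rightarrow> real ^ 'n)"

abbreviation dom_ch :: "('m, 'n::finite) chart \<Rightarrow> 'm set" where
  "dom_ch c \<equiv> fst c"

abbreviation coord :: "('m, 'n::finite) chart \<Rightarrow> 'm \<Rightarrow> real ^ 'n" where
  "coord c \<equiv> snd c"

definition ran_ch :: "('m, 'n::finite) chart \<Rightarrow> (real ^ 'n) set" where
  "ran_ch c = coord c ` dom_ch c"

definition param :: "('m, 'n::finite) chart \<Rightarrow> real ^ 'n \<Rightarrow> 'm" where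
  "param c = inv_into (dom_ch c) (coord c)"

definition is_chart :: "('m::topological_space, 'n::finite) chart \<Rightarrow> bool" where
  "is_chart c \<longleftrightarrow> open (dom_ch c) \<and> open (ran_ch c) \<and>
     homeomorphism (dom_ch c) (ran_ch c) (coord c) (param c)"

definition compatible :: "('m, 'n::finite) chart \<Rightarrow> ('m, 'n) chart \<Rightarrow> bool" where
  "compatible c d \<longleftrightarrow>
     smooth_on (coord c ` (dom_ch c \<inter> dom_ch d)) (coord d \<circ> param c) \<and>
     smooth_on (coord d ` (dom_ch c \<inter> dom_ch d)) (coord c \<circ> param d)"

definition smooth_structure :: "('m::topological_space, 'n::finite) chart set \<Rightarrow> bool" where
  "smooth_structure A \<longleftrightarrow>
     (\<forall>c\<in>A. is_chart c) \<and> (\<Union>c\<in>A. dom_ch c) = UNIV \<and>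
     (\<forall>c\<in>A. \<forall>d\<in>A. compatible c d) \<and>
     (\<forall>c. is_chart c \<and> (\<forall>d\<in>A. compatible c d) \<longrightarrow> c \<in> A)"


subsection \<open>Semi-Riemannian metrics\<close>

text \<open>A \<open>(0,2)\<close>-tensor field is given by its components in all charts, subject to the tensor
  transformation law: \<open>g c x\<close> is the component matrix at the point with coordinates \<open>x\<close>
  in the chart \<open>c\<close>.\<close>

type_synonym ('m, 'n) metric = "('m, 'n) chart \<Rightarrow> real ^ 'n \<Rightarrow> real ^ 'n ^ 'n"

definition semi_riemannian_manifold ::
    "('m::topological_space, 'n::finite) chart set \<Rightarrow> ('m, 'n) metric \<Rightarrow> bool" where
  "semi_riemannian_manifold A g \<longleftrightarrow> smooth_structure A \<and>
     (\<forall>c\<in>A. \<forall>i j. smooth_on (ran_ch c) (\<lambda>x. g c x $ i $ j)) \<and>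
     (\<forall>c\<in>A. \<forall>x\<in>ran_ch c. \<forall>v w. v \<bullet> (g c x *v w) = w \<bullet> (g c x *v v)) \<and>
     (\<forall>c\<in>A. \<forall>x\<in>ran_ch c. \<forall>v. (\<forall>w. v \<bullet> (g c x *v w) = 0) \<longrightarrow> v = 0) \<and>
     (\<forall>c\<in>A. \<forall>d\<in>A. \<forall>q\<in>dom_ch c \<inter> dom_ch d. \<forall>v w.
        let T = frechet_derivative (coord d \<circ> param c) (at (coord c q))
        in T v \<bullet> (g d (coord d q) *v T w) = v \<bullet> (g c (coord c q) *v w))"


subsection \<open>Levi-Civita connection and curvature in a chart\<close>

text \<open>Below, \<open>G\<close> is the matrix of metric components in a fixed chart, as a function of the
  coordinates, and vector fields are given by their components.\<close>

definition christoffel :: "(real ^ 'n \<Rightarrow> real ^ 'n ^ 'n) \<Rightarrow> real ^ 'n \<Rightarrow> 'n::finite \<Rightarrow> 'n \<Rightarrow> 'n \<Rightarrow> real" where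
  "christoffel G x i j k = (let D = \<lambda>l a b. frechet_derivative (\<lambda>y. G y $ a $ b) (at x) (axis l 1) in
     (1/2) * (\<Sum>l\<in>UNIV. matrix_inv (G x) $ i $ l * (D j k l + D k j l - D l j k)))"

definition nabla :: "(real ^ 'n \<Rightarrow> real ^ 'n ^ 'n) \<Rightarrow> (real ^ 'n::finite \<Rightarrow> real ^ 'n)
     \<Rightarrow> (real ^ 'n \<Rightarrow> real ^ 'n) \<Rightarrow> real ^ 'n \<Rightarrow> real ^ 'n" where
  "nabla G X Y x = frechet_derivative Y (at x) (X x) +
     (\<chi> i. \<Sum>j\<in>UNIV. \<Sum>k\<in>UNIV. christoffel G x i j k * X x $ j * Y x $ k)"

definition nabla2 :: "(real ^ 'n \<Rightarrow> real ^ 'n ^ 'n) \<Rightarrow> (real ^ 'n::finite \<Rightarrow> real ^ 'n)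
     \<Rightarrow> (real ^ 'n \<Rightarrow> real ^ 'n) \<Rightarrow> (real ^ 'n \<Rightarrow> real ^ 'n) \<Rightarrow> real ^ 'n \<Rightarrow> real ^ 'n" where
  "nabla2 G X Y Z x = nabla G X (nabla G Y Z) x - nabla G (nabla G X Y) Z x"

definition curvature :: "(real ^ 'n \<Rightarrow> real ^ 'n ^ 'n) \<Rightarrow> (real ^ 'n::finite \<Rightarrow> real ^ 'n)
     \<Rightarrow> (real ^ 'n \<Rightarrow> real ^ 'n) \<Rightarrow> (real ^ 'n \<Rightarrow> real ^ 'n) \<Rightarrow> real ^ 'n \<Rightarrow> real ^ 'n" where
  "curvature G X Y Z x = nabla2 G X Y Z x - nabla2 G Y X Z x"

text \<open>\<open>curv_mixed G x k l m i\<close> is \<open>R\<^sub>k\<^sub>l\<^sub>m\<^sup>i\<close>, \<open>curv_low G x i j k l\<close> is \<open>R\<^sub>i\<^sub>j\<^sub>k\<^sub>l\<close>, and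
  \<open>curv_up G x i j k l\<close> is \<open>R\<close> with the first and third index raised.\<close>

definition curv_mixed :: "(real ^ 'n \<Rightarrow> real ^ 'n ^ 'n) \<Rightarrow> real ^ 'n \<Rightarrow> 'n::finite \<Rightarrow> 'n \<Rightarrow> 'n \<Rightarrow> 'n \<Rightarrow> real" where
  "curv_mixed G x k l m i = curvature G (\<lambda>_. axis k 1) (\<lambda>_. axis l 1) (\<lambda>_. axis m 1) x $ i"

definition curv_low :: "(real ^ 'n \<Rightarrow> real ^ 'n ^ 'n) \<Rightarrow> real ^ 'n \<Rightarrow> 'n::finite \<Rightarrow> 'n \<Rightarrow> 'n \<Rightarrow> 'n \<Rightarrow> real" where
  "curv_low G x i j k l = (\<Sum>m\<in>UNIV. curv_mixed G x i j k m * G x $ m $ l)"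

definition curv_up :: "(real ^ 'n \<Rightarrow> real ^ 'n ^ 'n) \<Rightarrow> real ^ 'n \<Rightarrow> 'n::finite \<Rightarrow> 'n \<Rightarrow> 'n \<Rightarrow> 'n \<Rightarrow> real" where
  "curv_up G x i j k l = (\<Sum>a\<in>UNIV. \<Sum>b\<in>UNIV.
     matrix_inv (G x) $ i $ a * matrix_inv (G x) $ k $ b * curv_low G x a j b l)"


subsection \<open>Geodesics, exponential charts, locally symmetric spaces\<close>

definition geodesic_on ::
    "('m::topological_space, 'n::finite) chart set \<Rightarrow> ('m, 'n) metric \<Rightarrow> real set \<Rightarrow> (real \<Rightarrow> 'm) \<Rightarrow> bool" where
  "geodesic_on A g J \<gamma> \<longleftrightarrow> open J \<and> is_interval J \<and> continuous_on J \<gamma> \<and>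
     (\<forall>c\<in>A. \<exists>u'. \<forall>t\<in>J. \<gamma> t \<in> dom_ch c \<longrightarrow>
        ((coord c \<circ> \<gamma>) has_vector_derivative u' t) (at t) \<and>
        (u' has_vector_derivative
          - (\<chi> i. \<Sum>j\<in>UNIV. \<Sum>k\<in>UNIV.
               christoffel (g c) (coord c (\<gamma> t)) i j k * u' t $ j * u' t $ k)) (at t))"

text \<open>\<open>q = exp\<^sub>p(v)\<close>, where the tangent vector at \<open>p\<close> is given by its components \<open>v\<close> with respect
  to the coordinate basis of the chart \<open>c\<close> around \<open>p\<close>.\<close>

definition is_exp ::
    "('m::topological_space, 'n::finite) chart set \<Rightarrow> ('m, 'n) metric \<Rightarrow> ('m, 'n) chart
       \<Rightarrow> 'm \<Rightarrow> real ^ 'n \<Rightarrow> 'm \<Rightarrow> bool" where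
  "is_exp A g c p v q \<longleftrightarrow> (\<exists>J \<gamma>. {0..1} \<subseteq> J \<and> geodesic_on A g J \<gamma> \<and>
     \<gamma> 0 = p \<and> ((coord c \<circ> \<gamma>) has_vector_derivative v) (at 0) \<and> \<gamma> 1 = q)"

text \<open>The chart is the inverse of \<open>exp\<^sub>p\<close> on a star-shaped neighbourhood of \<open>0\<close>. Since the
  derivative of \<open>exp\<^sub>p\<close> at \<open>0\<close> is the identity, the identification of \<open>T\<^sub>pM\<close> with Euclidean space
  involved is the one given by the coordinate basis of the chart itself.\<close>

definition exponential_chart ::
    "('m::topological_space, 'n::finite) chart set \<Rightarrow> ('m, 'n) metric \<Rightarrow> 'm \<Rightarrow> ('m, 'n) chart \<Rightarrow> bool" where
  "exponential_chart A g p c \<longleftrightarrow> c \<in> A \<and> p \<in> dom_ch c \<and> coord c p = 0 \<and>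
     (\<forall>v\<in>ran_ch c. closed_segment 0 v \<subseteq> ran_ch c) \<and>
     (\<forall>v\<in>ran_ch c. is_exp A g c p v (param c v))"

definition geodesic_symmetry :: "('m, 'n::finite) chart \<Rightarrow> 'm \<Rightarrow> 'm" where
  "geodesic_symmetry c q = param c (- coord c q)"

definition isometric_on ::
    "('m::topological_space, 'n::finite) chart set \<Rightarrow> ('m, 'n) metric \<Rightarrow> 'm set \<Rightarrow> ('m \<Rightarrow> 'm) \<Rightarrow> bool" where
  "isometric_on A g U f \<longleftrightarrow> open U \<and> continuous_on U f \<and>
     (\<forall>c\<in>A. \<forall>d\<in>A.
        smooth_on (coord c ` (U \<inter> dom_ch c \<inter> f -` dom_ch d)) (coord d \<circ> f \<circ> param c) \<and>
        (\<forall>q\<in>U \<inter> dom_ch c \<inter> f -` dom_ch d. \<forall>v w.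
           let T = frechet_derivative (coord d \<circ> f \<circ> param c) (at (coord c q))
           in T v \<bullet> (g d (coord d (f q)) *v T w) = v \<bullet> (g c (coord c q) *v w)))"

text \<open>The symmetry condition on the range makes the geodesic symmetry an involution of the chart
  domain; it can always be achieved by shrinking an exponential chart.\<close>

definition locally_symmetric ::
    "('m::topological_space, 'n::finite) chart set \<Rightarrow> ('m, 'n) metric \<Rightarrow> bool" where
  "locally_symmetric A g \<longleftrightarrow> (\<forall>p. \<exists>c. exponential_chart A g p c \<and>
     uminus ` ran_ch c = ran_ch c \<and> isometric_on A g (dom_ch c) (geodesic_symmetry c))"


subsection \<open>The field of rational functions in three spectral parameters\<close>

type_synonym ratfun3 = "complex poly poly poly fract"

definition lam1 :: ratfun3 where "lam1 = Fraction_Field.Fract [:[:[:0, 1:]:]:] 1"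
definition lam2 :: ratfun3 where "lam2 = Fraction_Field.Fract [:[:0, 1:]:] 1"
definition lam3 :: ratfun3 where "lam3 = Fraction_Field.Fract [:0, 1:] 1"

definition const_rf :: "real \<Rightarrow> ratfun3" where
  "const_rf a = Fraction_Field.Fract [:[:[:complex_of_real a:]:]:] 1"


subsection \<open>Tensor products of endomorphisms\<close>

text \<open>With respect to the coordinate basis, \<open>End(V)\<close>, \<open>End(V) \<otimes> End(V) = End(V \<otimes> V)\<close> and
  \<open>End(V) \<otimes> End(V) \<otimes> End(V) = End(V \<otimes> V \<otimes> V)\<close> (tensored with a field \<open>'k\<close>) are matrices over
  \<open>'k\<close> indexed by \<open>'n\<close>, \<open>'n \<times> 'n\<close> and \<open>'n \<times> 'n \<times> 'n\<close>.\<close>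

text \<open>\<open>elem_end i j\<close> maps the \<open>j\<close>-th basis vector to the \<open>i\<close>-th one.\<close>

definition elem_end :: "'n::finite \<Rightarrow> 'n \<Rightarrow> 'k::field ^ 'n ^ 'n" where
  "elem_end i j = (\<chi> a b. if a = i \<and> b = j then 1 else 0)"

definition tensor :: "'k::field ^ 'n ^ 'n \<Rightarrow> 'k ^ 'n ^ 'n \<Rightarrow> 'k ^ ('n::finite \<times> 'n) ^ ('n \<times> 'n)" where
  "tensor S T = (\<chi> I J. S $ fst I $ fst J * T $ snd I $ snd J)"

definition scale_mat :: "'k::field \<Rightarrow> 'k ^ 'a::finite ^ 'b::finite \<Rightarrow> 'k ^ 'a ^ 'b" where
  "scale_mat s T = (\<chi> I J. s * T $ I $ J)"

definition leg12 :: "'k::field ^ ('n::finite \<times> 'n) ^ ('n \<times> 'n) \<Rightarrow> 'k ^ ('n \<times> 'n \<times> 'n) ^ ('n \<times> 'n \<times> 'n)" where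
  "leg12 T = (\<chi> I J. case (I, J) of ((a, b, c), (a', b', c')) \<Rightarrow>
     if c = c' then T $ (a, b) $ (a', b') else 0)"

definition leg13 :: "'k::field ^ ('n::finite \<times> 'n) ^ ('n \<times> 'n) \<Rightarrow> 'k ^ ('n \<times> 'n \<times> 'n) ^ ('n \<times> 'n \<times> 'n)" where
  "leg13 T = (\<chi> I J. case (I, J) of ((a, b, c), (a', b', c')) \<Rightarrow>
     if b = b' then T $ (a, c) $ (a', c') else 0)"

definition leg23 :: "'k::field ^ ('n::finite \<times> 'n) ^ ('n \<times> 'n) \<Rightarrow> 'k ^ ('n \<times> 'n \<times> 'n) ^ ('n \<times> 'n \<times> 'n)" where
  "leg23 T = (\<chi> I J. case (I, J) of ((a, b, c), (a', b', c')) \<Rightarrow>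
     if a = a' then T $ (b, c) $ (b', c') else 0)"

definition commutator :: "'k::field ^ 'a ^ 'a \<Rightarrow> 'k ^ 'a ^ 'a \<Rightarrow> 'k ^ 'a::finite ^ 'a" where
  "commutator S T = S ** T - T ** S"

text \<open>The coefficient field is taken to be that of all three spectral parameters from the start, so
  that \<open>r_hat G x lam1 lam2\<close>, \<open>r_hat G x lam1 lam3\<close> and \<open>r_hat G x lam2 lam3\<close> live in the same
  space.\<close>

definition r_hat :: "(real ^ 'n \<Rightarrow> real ^ 'n ^ 'n) \<Rightarrow> real ^ 'n \<Rightarrow> ratfun3 \<Rightarrow> ratfun3
     \<Rightarrow> ratfun3 ^ ('n::finite \<times> 'n) ^ ('n \<times> 'n)" where
  "r_hat G x \<mu> \<nu> = scale_mat (1 / (\<mu> - \<nu>))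
     (\<Sum>i\<in>UNIV. \<Sum>j\<in>UNIV. \<Sum>k\<in>UNIV. \<Sum>l\<in>UNIV.
        scale_mat (const_rf (curv_up G x i j k l)) (tensor (elem_end i j) (elem_end k l)))"

end

theory Submission
  imports Defs
begin

text \<open>
  Around a point of a locally symmetric space the metric is even in an exponential chart, since
  there the geodesic symmetry \<open>x \<mapsto> - x\<close> is an isometry. So at the centre of that chart the
  Christoffel symbols and the derivative of the curvature vanish, and pulling this back along the
  transition map gives \<open>\<nabla>R = 0\<close> at every point of any other chart. The Ricci identity then
  says that \<open>R\<close>, and with it the tensor \<open>t = \<Sum> R\<^sup>i\<^sub>j\<^sup>k\<^sub>l E\<^sub>i\<^sup>j \<otimes> E\<^sub>k\<^sup>l\<close>, is invariant under the curvature
  endomorphisms. By the symmetries of \<open>R\<close> both tensor factors of \<open>t\<close> consist of such endomorphisms,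
  whence \<open>[t\<^sub>1\<^sub>2, t\<^sub>1\<^sub>3 + t\<^sub>2\<^sub>3] = 0 = [t\<^sub>1\<^sub>2 + t\<^sub>1\<^sub>3, t\<^sub>2\<^sub>3]\<close>, and the Yang-Baxter equation reduces to the
  partial fraction identity for \<open>1 / (\<lambda>\<^sub>i - \<lambda>\<^sub>j)\<close>.
\<close>

subsection \<open>Smooth functions on open sets\<close>

text \<open>Level \<open>Suc k\<close> asks for differentiability and says nothing explicit about
  continuity; the base case recovers it, since differentiable functions are continuous.\<close>

lemma Ck_on_Suc_imp: "Ck_on (Suc k) S f \<Longrightarrow> Ck_on k S f"
proof (induction k arbitrary: f)
  case 0
  then show ?case
    by (auto intro!: differentiable_imp_continuous_on simp: differentiable_on_def differentiable_at_withinI)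
next
  case (Suc k)
  have "Ck_on k S (\<lambda>x. frechet_derivative f (at x) v)" for v
    using Suc.prems by (intro Suc.IH) (simp only: Ck_on.simps, blast)
  then show ?case using Suc.prems unfolding Ck_on.simps(2)[of k] by simp
qed

text \<open>On an open set, derivatives depend only on nearby values inside the set. This lets
  derivatives be replaced by closed formulas that are known only at points of
  \<open>S\<close>.\<close>

lemma Ck_on_cong:
  assumes "open S" "\<And>x. x \<in> S \<Longrightarrow> f x = g x" "Ck_on k S f"
  shows "Ck_on k S g"
  using assms(2,3)
proof (induction k arbitrary: f g)
  case 0
  then show ?case by (metis Ck_on.simps(1) continuous_on_cong)
next
  case (Suc k)
  have diff: "g differentiable at x" if "x \<in> S" for x
    using Suc.prems that assms(1) unfolding differentiable_def
    by (metis Ck_on.simps(2) differentiable_def has_derivative_transform_within_open)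
  have "frechet_derivative f (at x) = frechet_derivative g (at x)" if "x \<in> S" for x
    using Suc.prems that assms(1) by (intro frechet_derivative_transform_within_open[where X=S]) auto
  then have "Ck_on k S (\<lambda>x. frechet_derivative g (at x) v)" for v
    using Suc.prems(2) by (intro Suc.IH[where f="\<lambda>x. frechet_derivative f (at x) v" and g="\<lambda>x. frechet_derivative g (at x) v"]) simp_all
  with diff show ?case by simp
qed

lemma Ck_on_const: "Ck_on k S (\<lambda>_. c)"
  by (induction k arbitrary: c) auto

lemma Ck_on_add:
  assumes "open S" "Ck_on k S f" "Ck_on k S g"
  shows "Ck_on k S (\<lambda>x. f x + g x)"
  using assms(2,3)
proof (induction k arbitrary: f g)
  case 0 then show ?case by (simp add: continuous_on_add)
next
  case (Suc k)
  have eq: "frechet_derivative (\<lambda>x. f x + g x) (at x) v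
      = frechet_derivative f (at x) v + frechet_derivative g (at x) v" if "x \<in> S" for x v
  proof -
    have "((\<lambda>x. f x + g x) has_derivative
        (\<lambda>v. frechet_derivative f (at x) v + frechet_derivative g (at x) v)) (at x)"
      using Suc.prems that by (intro has_derivative_add) (auto simp: frechet_derivative_works[symmetric])
    from frechet_derivative_at[OF this, symmetric] show ?thesis by simp
  qed
  have *: "Ck_on k S (\<lambda>x. frechet_derivative f (at x) v + frechet_derivative g (at x) v)" for v
    using Suc by simp
  have "Ck_on k S (\<lambda>x. frechet_derivative (\<lambda>x. f x + g x) (at x) v)" for v
    by (rule Ck_on_cong[OF assms(1) eq[symmetric] *])
  then show ?case using Suc.prems by simp
qed

text \<open>The product rule returns the undifferentiated factors next to derivatives, so the
  induction also uses these factors at the lower order \<open>k\<close>.\<close>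

lemma Ck_on_scaleR:
  fixes f :: "'a::real_normed_vector \<Rightarrow> real"
  assumes "open S" "Ck_on k S f" "Ck_on k S g"
  shows "Ck_on k S (\<lambda>x. f x *\<^sub>R g x)"
  using assms(2,3)
proof (induction k arbitrary: f g)
  case 0 then show ?case unfolding Ck_on.simps by (rule continuous_on_scaleR)
next
  case (Suc k)
  have eq: "frechet_derivative (\<lambda>x. f x *\<^sub>R g x) (at x) v
      = f x *\<^sub>R frechet_derivative g (at x) v + frechet_derivative f (at x) v *\<^sub>R g x"
    if "x \<in> S" for x v
  proof -
    have "(f has_derivative frechet_derivative f (at x)) (at x)" "(g has_derivative frechet_derivative g (at x)) (at x)"
      using Suc.prems that by (auto simp: frechet_derivative_works[symmetric])
    then have "((\<lambda>x. f x *\<^sub>R g x) has_derivative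
        (\<lambda>v. f x *\<^sub>R frechet_derivative g (at x) v + frechet_derivative f (at x) v *\<^sub>R g x)) (at x)"
      by (rule has_derivative_scaleR)
    from frechet_derivative_at[OF this, symmetric] show ?thesis by simp
  qed
  have *: "Ck_on k S (\<lambda>x. f x *\<^sub>R frechet_derivative g (at x) v + frechet_derivative f (at x) v *\<^sub>R g x)" for v
    using Suc.prems Suc.prems[THEN Ck_on_Suc_imp] by (intro Ck_on_add[OF assms(1)] Suc.IH) simp_all
  have "Ck_on k S (\<lambda>x. frechet_derivative (\<lambda>x. f x *\<^sub>R g x) (at x) v)" for v
    by (rule Ck_on_cong[OF assms(1) eq[symmetric] *])
  then show ?case using Suc.prems by simp
qed

lemma Ck_on_inverse:
  fixes f :: "'a::real_normed_vector \<Rightarrow> real"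
  assumes "open S" "Ck_on k S f" "\<And>x. x \<in> S \<Longrightarrow> f x \<noteq> 0"
  shows "Ck_on k S (\<lambda>x. inverse (f x))"
  using assms(2)
proof (induction k)
  case 0 then show ?case using assms(3) unfolding Ck_on.simps by (intro continuous_on_inverse) auto
next
  case (Suc k)
  have der: "((\<lambda>x. inverse (f x)) has_derivative
        (\<lambda>v. - (inverse (f x) * frechet_derivative f (at x) v * inverse (f x)))) (at x)"
    if "x \<in> S" for x
    using Suc.prems that assms(3)
    by (intro Deriv.has_derivative_inverse) (auto simp: frechet_derivative_works[symmetric])
  \<comment> \<open>The derivative contains \<open>inverse (f x)\<close> again, but only at order
    \<open>k\<close>, where the induction hypothesis applies. Nested scalings bring it into the form
    of the product lemma.\<close>
  have eq: "frechet_derivative (\<lambda>x. inverse (f x)) (at x) v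
      = (- 1) *\<^sub>R inverse (f x) *\<^sub>R frechet_derivative f (at x) v *\<^sub>R inverse (f x)" if "x \<in> S" for x v
    using frechet_derivative_at[OF der[OF that], symmetric] by simp
  have *: "Ck_on k S (\<lambda>x. (- 1) *\<^sub>R inverse (f x) *\<^sub>R frechet_derivative f (at x) v *\<^sub>R inverse (f x))" for v
    using Suc.prems Suc.IH[OF Ck_on_Suc_imp[OF Suc.prems]]
    by (intro Ck_on_scaleR[OF assms(1)] Ck_on_const) auto
  have "Ck_on k S (\<lambda>x. frechet_derivative (\<lambda>x. inverse (f x)) (at x) v)" for v
    by (rule Ck_on_cong[OF assms(1) eq[symmetric] *])
  then show ?case using der by (auto simp: differentiable_def)
qed

section \<open>Smooth functions and their closure properties\<close>

lemma smooth_on_differentiable: "smooth_on S f \<Longrightarrow> x \<in> S \<Longrightarrow> f differentiable at x"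
  unfolding smooth_on_def by (metis Ck_on.simps(2))

lemma smooth_on_has_derivative:
  "smooth_on S f \<Longrightarrow> x \<in> S \<Longrightarrow> (f has_derivative frechet_derivative f (at x)) (at x)"
  using smooth_on_differentiable frechet_derivative_works by blast

lemma smooth_on_continuous: "smooth_on S f \<Longrightarrow> continuous_on S f"
  unfolding smooth_on_def by (metis Ck_on.simps(1))

lemma smooth_on_frechet_derivative:
  "smooth_on S f \<Longrightarrow> smooth_on S (\<lambda>x. frechet_derivative f (at x) v)"
  unfolding smooth_on_def by (metis Ck_on.simps(2))

lemma smooth_on_cong:
  "open S \<Longrightarrow> smooth_on S f \<Longrightarrow> (\<And>x. x \<in> S \<Longrightarrow> f x = g x) \<Longrightarrow> smooth_on S g"
  unfolding smooth_on_def by (metis Ck_on_cong)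

lemma smooth_on_const: "smooth_on S (\<lambda>_. c)"
  by (simp add: smooth_on_def Ck_on_const)

lemma smooth_on_add:
  "open S \<Longrightarrow> smooth_on S f \<Longrightarrow> smooth_on S g \<Longrightarrow> smooth_on S (\<lambda>x. f x + g x)"
  by (simp add: smooth_on_def Ck_on_add)

lemma smooth_on_scaleR:
  fixes f :: "'a::real_normed_vector \<Rightarrow> real"
  shows "open S \<Longrightarrow> smooth_on S f \<Longrightarrow> smooth_on S g \<Longrightarrow> smooth_on S (\<lambda>x. f x *\<^sub>R g x)"
  by (simp add: smooth_on_def Ck_on_scaleR)

lemma smooth_on_mult:
  fixes f g :: "'a::real_normed_vector \<Rightarrow> real"
  shows "open S \<Longrightarrow> smooth_on S f \<Longrightarrow> smooth_on S g \<Longrightarrow> smooth_on S (\<lambda>x. f x * g x)"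
  using smooth_on_scaleR[of S f g] by simp

lemma smooth_on_minus:
  assumes "open S" "smooth_on S f"
  shows "smooth_on S (\<lambda>x. - f x)"
  using smooth_on_scaleR[OF assms(1) smooth_on_const[of S "-1"] assms(2)] by simp

lemma smooth_on_diff:
  assumes "open S" "smooth_on S f" "smooth_on S g"
  shows "smooth_on S (\<lambda>x. f x - g x)"
  using smooth_on_add[OF assms(1,2) smooth_on_minus[OF assms(1,3)]] by simp

lemma smooth_on_inverse:
  fixes f :: "'a::real_normed_vector \<Rightarrow> real"
  shows "open S \<Longrightarrow> smooth_on S f \<Longrightarrow> (\<And>x. x \<in> S \<Longrightarrow> f x \<noteq> 0) \<Longrightarrow> smooth_on S (\<lambda>x. inverse (f x))"
  by (simp add: smooth_on_def Ck_on_inverse)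

lemma smooth_on_sum:
  "open S \<Longrightarrow> (\<And>i. i \<in> I \<Longrightarrow> smooth_on S (f i)) \<Longrightarrow> smooth_on S (\<lambda>x. \<Sum>i\<in>I. f i x)"
  by (induction I rule: infinite_finite_induct) (auto intro: smooth_on_const smooth_on_add)

lemma smooth_on_prod:
  fixes f :: "'i \<Rightarrow> 'a::real_normed_vector \<Rightarrow> real"
  shows "open S \<Longrightarrow> (\<And>i. i \<in> I \<Longrightarrow> smooth_on S (f i)) \<Longrightarrow> smooth_on S (\<lambda>x. \<Prod>i\<in>I. f i x)"
  by (induction I rule: infinite_finite_induct) (auto intro: smooth_on_const smooth_on_mult)

lemma smooth_on_vec:
  fixes f :: "'a::real_normed_vector \<Rightarrow> real ^ 'n::finite"
  assumes "open S" "\<And>i. smooth_on S (\<lambda>x. f x $ i)"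
  shows "smooth_on S f"
proof -
  have "smooth_on S (\<lambda>x. \<Sum>i\<in>UNIV. (f x $ i) *\<^sub>R axis i 1)"
    by (intro smooth_on_sum[OF assms(1)] smooth_on_scaleR[OF assms(1) assms(2) smooth_on_const])
  then show ?thesis
    by (rule smooth_on_cong[OF assms(1)]) (simp only: basis_expansion flip: scalar_mult_eq_scaleR)
qed

section \<open>Determinants and matrix inverses\<close>

lemma smooth_on_det:
  fixes M :: "'a::real_normed_vector \<Rightarrow> real ^ 'n ^ 'n::finite"
  assumes "open S" "\<And>i j. smooth_on S (\<lambda>x. M x $ i $ j)"
  shows "smooth_on S (\<lambda>x. det (M x))"
  unfolding det_def
  by (intro smooth_on_sum smooth_on_mult smooth_on_prod smooth_on_const assms)

lemma matrix_inv_inverse: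
  fixes M :: "real ^ 'n ^ 'n::finite"
  assumes "invertible M"
  shows "M ** matrix_inv M = mat 1" "matrix_inv M ** M = mat 1"
  using someI_ex[OF assms[unfolded invertible_def]] unfolding matrix_inv_def by auto

text \<open>By Cramer's rule each entry of the inverse is a quotient of determinants with
  nonvanishing denominator.\<close>

lemma smooth_on_matrix_inv:
  fixes M :: "'a::real_normed_vector \<Rightarrow> real ^ 'n ^ 'n::finite"
  assumes "open S" "\<And>i j. smooth_on S (\<lambda>x. M x $ i $ j)" "\<And>x. x \<in> S \<Longrightarrow> invertible (M x)"
  shows "smooth_on S (\<lambda>x. matrix_inv (M x) $ i $ j)"
proof -
  \<comment> \<open>The numerator matrix of Cramer's rule: column \<open>i\<close> of
    \<open>M x\<close> is replaced by the \<open>j\<close>-th basis vector.\<close>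
  define C where "C x = (\<chi> a b. if b = i then axis j 1 $ a else M x $ a $ b)" for x
  have "smooth_on S (\<lambda>x. C x $ a $ b)" for a b
    by (cases "b = i") (simp_all add: C_def smooth_on_const assms(2))
  then have sm: "smooth_on S (\<lambda>x. det (C x) * inverse (det (M x)))"
    using assms by (intro smooth_on_mult smooth_on_inverse smooth_on_det) (auto simp: invertible_det_nz)
  have "matrix_inv (M x) $ i $ j = det (C x) * inverse (det (M x))" if "x \<in> S" for x
  proof -
    have "M x *v (matrix_inv (M x) *v axis j 1) = axis j 1"
      using assms(3)[OF that] by (simp add: matrix_vector_mul_assoc matrix_inv_inverse)
    then have "(matrix_inv (M x) *v axis j 1) $ i = det (C x) / det (M x)"
      using assms(3)[OF that] by (subst (asm) cramer) (simp_all add: invertible_det_nz C_def)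
    then show ?thesis by (simp add: matrix_vector_mult_basis column_def divide_inverse)
  qed
  then show ?thesis using smooth_on_cong[OF assms(1) sm] by simp
qed

section \<open>Symmetry of second derivatives\<close>

text \<open>The mean value theorem is applied twice: to the increment along \<open>v\<close> as a
  function of the position along \<open>u\<close>, and then along \<open>v\<close> to the resulting
  derivative in direction \<open>u\<close>.\<close>

lemma second_difference_mvt:
  fixes f :: "'a::real_normed_vector \<Rightarrow> real"
  assumes "smooth_on S f" "t > 0"
    "\<And>r s. r \<in> {0..t} \<Longrightarrow> s \<in> {0..t} \<Longrightarrow> x + r *\<^sub>R u + s *\<^sub>R v \<in> S"
  obtains r s where "r \<in> {0..t}" "s \<in> {0..t}"
    "f (x + t *\<^sub>R u + t *\<^sub>R v) - f (x + t *\<^sub>R u) - f (x + t *\<^sub>R v) + f x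
      = t * (t * frechet_derivative (\<lambda>y. frechet_derivative f (at y) u) (at (x + r *\<^sub>R u + s *\<^sub>R v)) v)"
proof -
  define F where "F y = frechet_derivative f (at y) u" for y
  have smF: "smooth_on S F" unfolding F_def by (rule smooth_on_frechet_derivative[OF assms(1)])
  have line: "((\<lambda>z. g (a + z *\<^sub>R w)) has_derivative (\<lambda>z. z * frechet_derivative g (at (a + b *\<^sub>R w)) w)) (at b)"
    if "smooth_on S g" "a + b *\<^sub>R w \<in> S" for g :: "'a \<Rightarrow> real" and a b w
  proof -
    have "((\<lambda>z. g (a + z *\<^sub>R w)) has_derivative (\<lambda>z. frechet_derivative g (at (a + b *\<^sub>R w)) (z *\<^sub>R w))) (at b)"
      using that by (intro has_derivative_compose[where f="\<lambda>z. a + z *\<^sub>R w" and g=g]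
          smooth_on_has_derivative[of S]) (auto intro!: derivative_eq_intros)
    then show ?thesis
      by (simp add: linear_scale[OF linear_frechet_derivative[OF smooth_on_differentiable[OF that]]])
  qed
  define h where "h r = f (x + t *\<^sub>R v + r *\<^sub>R u) - f (x + r *\<^sub>R u)" for r
  define h' where "h' r z = z * F (x + t *\<^sub>R v + r *\<^sub>R u) - z * F (x + r *\<^sub>R u)" for r z
  have "(h has_derivative h' r) (at r)" if "r \<in> {0..t}" for r
    unfolding h_def h'_def F_def using assms(3)[OF that, of t] assms(3)[OF that, of 0] assms(2)
    by (intro has_derivative_diff line[OF assms(1)]) (simp_all add: algebra_simps)
  then have "\<exists>r\<in>{0<..<t}. h t - h 0 = h' r (t - 0)"
    using assms(2) by (intro mvt_simple) (simp_all add: has_derivative_at_withinI)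
  then obtain r where r: "r \<in> {0..t}" "h t - h 0 = t * (F (x + t *\<^sub>R v + r *\<^sub>R u) - F (x + r *\<^sub>R u))"
    unfolding h'_def right_diff_distrib diff_0_right by (meson atLeastAtMost_iff greaterThanLessThan_iff less_le)
  define k where "k s = F (x + r *\<^sub>R u + s *\<^sub>R v)" for s
  define k' where "k' s z = z * frechet_derivative F (at (x + r *\<^sub>R u + s *\<^sub>R v)) v" for s z
  have "(k has_derivative k' s) (at s)" if "s \<in> {0..t}" for s
    unfolding k_def k'_def by (rule line[OF smF assms(3)[OF r(1) that]])
  then have "\<exists>s\<in>{0<..<t}. k t - k 0 = k' s (t - 0)"
    using assms(2) by (intro mvt_simple) (simp_all add: has_derivative_at_withinI)
  then obtain s where s: "s \<in> {0..t}" "k t - k 0 = t * frechet_derivative F (at (x + r *\<^sub>R u + s *\<^sub>R v)) v"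
    unfolding k'_def diff_0_right by (meson atLeastAtMost_iff greaterThanLessThan_iff less_le)
  have "h t - h 0 = t * (k t - k 0)" using r(2) by (simp add: k_def algebra_simps)
  moreover have "(\<lambda>y. frechet_derivative f (at y) u) = F" by (simp add: F_def fun_eq_iff)
  ultimately show ?thesis
    using that[OF r(1) s(1)] unfolding s(2) by (simp add: h_def algebra_simps)
qed

text \<open>The second difference is symmetric in \<open>u\<close> and \<open>v\<close>, and it
  equals \<open>t * t\<close> times either mixed derivative at some point of a small parallelogram.
  By continuity both values approach those at \<open>x\<close> as the parallelogram shrinks.\<close>

lemma second_derivative_symmetric_real:
  fixes f :: "'a::real_normed_vector \<Rightarrow> real"
  assumes "open S" "smooth_on S f" "x \<in> S"
  shows "frechet_derivative (\<lambda>y. frechet_derivative f (at y) u) (at x) v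
       = frechet_derivative (\<lambda>y. frechet_derivative f (at y) v) (at x) u"
proof -
  define A where "A y = frechet_derivative (\<lambda>y. frechet_derivative f (at y) u) (at y) v" for y
  define B where "B y = frechet_derivative (\<lambda>y. frechet_derivative f (at y) v) (at y) u" for y
  have cont: "isCont A x" "isCont B x"
    unfolding A_def B_def using assms
    by (auto intro!: continuous_on_interior[OF smooth_on_continuous] smooth_on_frechet_derivative
        simp: interior_open)
  have "\<bar>A x - B x\<bar> \<le> e" if "e > 0" for e
  proof -
    obtain d1 where d1: "d1 > 0" "\<And>y. dist y x < d1 \<Longrightarrow> \<bar>A y - A x\<bar> < e / 2"
      using cont(1)[unfolded continuous_at_eps_delta dist_real_def] \<open>e > 0\<close> half_gt_zero by blast
    obtain d2 where d2: "d2 > 0" "\<And>y. dist y x < d2 \<Longrightarrow> \<bar>B y - B x\<bar> < e / 2"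
      using cont(2)[unfolded continuous_at_eps_delta dist_real_def] \<open>e > 0\<close> half_gt_zero by blast
    obtain d3 where d3: "d3 > 0" "\<And>y. dist y x < d3 \<Longrightarrow> y \<in> S"
      using assms(1,3) unfolding open_dist by blast
    define d where "d = min d1 (min d2 d3)"
    \<comment> \<open>With this size the parallelogram with sides \<open>t *\<^sub>R u\<close> and
      \<open>t *\<^sub>R v\<close> stays within distance \<open>d\<close> of \<open>x\<close>; the
      summand 1 excludes a zero denominator and makes the estimate strict.\<close>
    define t where "t = d / (norm u + norm v + 1)"
    have "d > 0" using d1 d2 d3 by (simp add: d_def)
    then have t: "t > 0" unfolding t_def by (simp add: add_nonneg_pos)
    have near: "dist (x + r *\<^sub>R u + s *\<^sub>R v) x < d" if "r \<in> {0..t}" "s \<in> {0..t}" for r s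
    proof -
      have "dist (x + r *\<^sub>R u + s *\<^sub>R v) x = norm (r *\<^sub>R u + s *\<^sub>R v)" by (simp add: dist_norm)
      also have "\<dots> \<le> r * norm u + s * norm v"
        using norm_triangle_ineq[of "r *\<^sub>R u" "s *\<^sub>R v"] that by simp
      also have "\<dots> \<le> t * norm u + t * norm v" using that by (intro add_mono mult_right_mono) auto
      also have "\<dots> < t * (norm u + norm v + 1)" using t by (simp add: algebra_simps)
      also have "\<dots> = d" unfolding t_def using add_nonneg_pos[of "norm u + norm v" 1] by simp
      finally show ?thesis .
    qed
    have S1: "x + r *\<^sub>R u + s *\<^sub>R v \<in> S" if "r \<in> {0..t}" "s \<in> {0..t}" for r s
      using near[OF that] d3 by (simp add: d_def)
    have S2: "x + r *\<^sub>R v + s *\<^sub>R u \<in> S" if "r \<in> {0..t}" "s \<in> {0..t}" for r s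
      using S1[OF that(2,1)] by (simp add: algebra_simps)
    obtain r s where rs: "r \<in> {0..t}" "s \<in> {0..t}"
      "f (x + t *\<^sub>R u + t *\<^sub>R v) - f (x + t *\<^sub>R u) - f (x + t *\<^sub>R v) + f x = t * (t * A (x + r *\<^sub>R u + s *\<^sub>R v))"
      unfolding A_def using second_difference_mvt[OF assms(2) t, of x u v] S1 by blast
    obtain r' s' where rs': "r' \<in> {0..t}" "s' \<in> {0..t}"
      "f (x + t *\<^sub>R v + t *\<^sub>R u) - f (x + t *\<^sub>R v) - f (x + t *\<^sub>R u) + f x = t * (t * B (x + r' *\<^sub>R v + s' *\<^sub>R u))"
      unfolding B_def using second_difference_mvt[OF assms(2) t, of x v u] S2 by blast
    have "t * (t * A (x + r *\<^sub>R u + s *\<^sub>R v)) = t * (t * B (x + r' *\<^sub>R v + s' *\<^sub>R u))"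
      unfolding rs(3)[symmetric] rs'(3)[symmetric] by (simp add: algebra_simps)
    then have "A (x + r *\<^sub>R u + s *\<^sub>R v) = B (x + s' *\<^sub>R u + r' *\<^sub>R v)" using t by (simp add: algebra_simps)
    moreover have "\<bar>A (x + r *\<^sub>R u + s *\<^sub>R v) - A x\<bar> < e / 2"
      using near[OF rs(1,2)] by (intro d1) (simp add: d_def)
    moreover have "\<bar>B (x + s' *\<^sub>R u + r' *\<^sub>R v) - B x\<bar> < e / 2"
      using near[OF rs'(2,1)] by (intro d2) (simp add: d_def)
    ultimately show ?thesis by argo
  qed
  then have "\<bar>A x - B x\<bar> \<le> 0" by (metis dense_ge)
  then show ?thesis by (simp add: A_def B_def)
qed

lemma frechet_derivative_inner_left:
  assumes "f differentiable at x"
  shows "frechet_derivative (\<lambda>y. f y \<bullet> b) (at x) v = frechet_derivative f (at x) v \<bullet> b"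
  using fun_cong[OF frechet_derivative_at[OF has_derivative_inner_left[OF assms[unfolded frechet_derivative_works]]]]
  by simp

lemma Ck_on_inner_left:
  assumes "open S" "Ck_on k S f"
  shows "Ck_on k S (\<lambda>x. f x \<bullet> b)"
  using assms(2)
proof (induction k arbitrary: f)
  case 0
  then show ?case by (auto intro: continuous_intros)
next
  case (Suc k)
  have eq: "frechet_derivative f (at y) v \<bullet> b = frechet_derivative (\<lambda>y. f y \<bullet> b) (at y) v"
    if "y \<in> S" for y v
    using Suc.prems that by (simp add: frechet_derivative_inner_left)
  have "Ck_on k S (\<lambda>y. frechet_derivative f (at y) v \<bullet> b)" for v
    using Suc.prems by (intro Suc.IH) simp
  note Ck_on_cong[OF assms(1) eq this]
  moreover have "(\<lambda>y. f y \<bullet> b) differentiable at y" if "y \<in> S" for y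
    using Suc.prems that
    by (intro differentiableI[OF has_derivative_inner_left[OF iffD1[OF frechet_derivative_works]]]) simp
  ultimately show ?case by simp
qed

lemma smooth_on_inner_left: "open S \<Longrightarrow> smooth_on S f \<Longrightarrow> smooth_on S (\<lambda>x. f x \<bullet> b)"
  by (simp add: smooth_on_def Ck_on_inner_left)

text \<open>Inner products with basis vectors reduce the claim to real-valued functions.\<close>

lemma second_derivative_symmetric:
  fixes f :: "'a::real_normed_vector \<Rightarrow> 'b::euclidean_space"
  assumes "open S" "smooth_on S f" "x \<in> S"
  shows "frechet_derivative (\<lambda>y. frechet_derivative f (at y) u) (at x) v
       = frechet_derivative (\<lambda>y. frechet_derivative f (at y) v) (at x) u"
proof (rule euclidean_eqI)
  fix b :: 'b
  have "frechet_derivative (\<lambda>y. frechet_derivative f (at y) u) (at x) v \<bullet> b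
      = frechet_derivative (\<lambda>y. frechet_derivative (\<lambda>y. f y \<bullet> b) (at y) u) (at x) v" for u v
  proof -
    have sm: "smooth_on S (\<lambda>y. frechet_derivative f (at y) u)"
      by (rule smooth_on_frechet_derivative[OF assms(2)])
    have "frechet_derivative (\<lambda>y. frechet_derivative f (at y) u) (at x) v \<bullet> b
        = frechet_derivative (\<lambda>y. frechet_derivative f (at y) u \<bullet> b) (at x) v"
      by (rule frechet_derivative_inner_left[symmetric, OF smooth_on_differentiable[OF sm assms(3)]])
    also have "\<dots> = frechet_derivative (\<lambda>y. frechet_derivative (\<lambda>y. f y \<bullet> b) (at y) u) (at x) v"
      by (rule fun_cong[OF frechet_derivative_transform_within_open[OF _ assms(1,3)]])
        (use smooth_on_differentiable[OF smooth_on_inner_left[OF assms(1) sm] assms(3)] in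
          \<open>simp_all add: frechet_derivative_inner_left smooth_on_differentiable[OF assms(2)]\<close>)
    finally show ?thesis .
  qed
  then show "frechet_derivative (\<lambda>y. frechet_derivative f (at y) u) (at x) v \<bullet> b
      = frechet_derivative (\<lambda>y. frechet_derivative f (at y) v) (at x) u \<bullet> b"
    using second_derivative_symmetric_real[OF assms(1) smooth_on_inner_left[OF assms(1,2)] assms(3)] by simp
qed

section \<open>Product rules for multilinear expressions with varying arguments\<close>

text \<open>Expanding the argument in the finite basis writes \<open>F y (a y)\<close> as a sum of
  scalar functions times the fields \<open>F y i\<close>, to which the ordinary product rule
  applies. Thus \<open>F\<close> only has to be differentiated with its argument frozen.\<close>

lemma has_derivative_linear_slot:
  fixes F :: "'a::real_normed_vector \<Rightarrow> 'e::euclidean_space \<Rightarrow> 'b::real_normed_vector"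
  assumes "open U" "x \<in> U" "\<And>y. y \<in> U \<Longrightarrow> linear (F y)"
    and F': "\<And>b. ((\<lambda>y. F y b) has_derivative (\<lambda>z. F' z b)) (at x)"
    and a: "(a has_derivative a') (at x)"
  shows "((\<lambda>y. F y (a y)) has_derivative (\<lambda>z. F' z (a x) + F x (a' z))) (at x)"
proof -
  have expand: "F y b = (\<Sum>i\<in>Basis. (b \<bullet> i) *\<^sub>R F y i)" if "y \<in> U" for y b
  proof -
    have "F y b = F y (\<Sum>i\<in>Basis. (b \<bullet> i) *\<^sub>R i)" by (simp only: euclidean_representation)
    then show ?thesis by (simp add: linear_sum[OF assms(3)[OF that]] linear_scale[OF assms(3)[OF that]])
  qed
  have "((\<lambda>y. \<Sum>i\<in>Basis. (b \<bullet> i) *\<^sub>R F y i) has_derivative (\<lambda>z. \<Sum>i\<in>Basis. (b \<bullet> i) *\<^sub>R F' z i)) (at x)" for b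
    by (intro has_derivative_sum has_derivative_scaleR_right F')
  then have "((\<lambda>y. F y b) has_derivative (\<lambda>z. \<Sum>i\<in>Basis. (b \<bullet> i) *\<^sub>R F' z i)) (at x)" for b
    by (rule has_derivative_transform_within_open[OF _ assms(1,2)]) (simp add: expand)
  \<comment> \<open>Linearity of \<open>F' z\<close> in the slot is inherited from
    \<open>F y\<close> by uniqueness of derivatives.\<close>
  then have expand': "F' z b = (\<Sum>i\<in>Basis. (b \<bullet> i) *\<^sub>R F' z i)" for z b
    by (rule fun_cong[OF has_derivative_unique[OF F']])
  have "((\<lambda>y. \<Sum>i\<in>Basis. (a y \<bullet> i) *\<^sub>R F y i) has_derivative
      (\<lambda>z. \<Sum>i\<in>Basis. (a x \<bullet> i) *\<^sub>R F' z i + (a' z \<bullet> i) *\<^sub>R F x i)) (at x)"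
    by (intro has_derivative_sum has_derivative_scaleR has_derivative_inner_left F' a)
  then have "((\<lambda>y. F y (a y)) has_derivative
      (\<lambda>z. \<Sum>i\<in>Basis. (a x \<bullet> i) *\<^sub>R F' z i + (a' z \<bullet> i) *\<^sub>R F x i)) (at x)"
    by (rule has_derivative_transform_within_open[OF _ assms(1,2)]) (simp add: expand)
  then show ?thesis
    by (subst expand', subst expand[OF assms(2)]) (simp add: sum.distrib)
qed

lemma has_derivative_linear_slot2:
  fixes F :: "'a::real_normed_vector \<Rightarrow> 'e::euclidean_space \<Rightarrow> 'e \<Rightarrow> 'b::real_normed_vector"
  assumes "open U" "x \<in> U"
    "\<And>y b. y \<in> U \<Longrightarrow> linear (\<lambda>a. F y a b)" "\<And>y a. y \<in> U \<Longrightarrow> linear (\<lambda>b. F y a b)"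
    "\<And>a b. ((\<lambda>y. F y a b) has_derivative (\<lambda>z. F' z a b)) (at x)"
    "(a has_derivative a') (at x)" "(b has_derivative b') (at x)"
  shows "((\<lambda>y. F y (a y) (b y)) has_derivative
    (\<lambda>z. F' z (a x) (b x) + F x (a' z) (b x) + F x (a x) (b' z))) (at x)"
  by (rule has_derivative_linear_slot[where F="\<lambda>y b. F y (a y) b" and F'="\<lambda>z b. F' z (a x) b + F x (a' z) b",
        OF assms(1,2,4) has_derivative_linear_slot[OF assms(1,2,3,5,6)] assms(7)])

lemma has_derivative_linear_slot3:
  fixes F :: "'a::real_normed_vector \<Rightarrow> 'e::euclidean_space \<Rightarrow> 'e \<Rightarrow> 'e \<Rightarrow> 'b::real_normed_vector"
  assumes "open U" "x \<in> U"
    "\<And>y b c. y \<in> U \<Longrightarrow> linear (\<lambda>a. F y a b c)" "\<And>y a c. y \<in> U \<Longrightarrow> linear (\<lambda>b. F y a b c)"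
    "\<And>y a b. y \<in> U \<Longrightarrow> linear (\<lambda>c. F y a b c)"
    "\<And>a b c. ((\<lambda>y. F y a b c) has_derivative (\<lambda>z. F' z a b c)) (at x)"
    "(a has_derivative a') (at x)" "(b has_derivative b') (at x)" "(c has_derivative c') (at x)"
  shows "((\<lambda>y. F y (a y) (b y) (c y)) has_derivative
    (\<lambda>z. F' z (a x) (b x) (c x) + F x (a' z) (b x) (c x) + F x (a x) (b' z) (c x) + F x (a x) (b x) (c' z))) (at x)"
  by (rule has_derivative_linear_slot[where F="\<lambda>y c. F y (a y) (b y) c"
        and F'="\<lambda>z c. F' z (a x) (b x) c + F x (a' z) (b x) c + F x (a x) (b' z) c",
        OF assms(1,2,5) has_derivative_linear_slot2[OF assms(1,2,3,4,6-8)] assms(9)])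

text \<open>Additivity and homogeneity of \<open>F y\<close> hold for all \<open>y\<close> near
  \<open>x\<close>, so both sides may be differentiated.\<close>

lemma linear_frechet_derivative_slot:
  fixes F :: "'a::real_normed_vector \<Rightarrow> 'e::real_vector \<Rightarrow> 'b::real_normed_vector"
  assumes "open U" "x \<in> U" "\<And>y. y \<in> U \<Longrightarrow> linear (F y)"
    and "\<And>b. (\<lambda>y. F y b) differentiable at x"
  shows "linear (\<lambda>b. frechet_derivative (\<lambda>y. F y b) (at x) z)"
proof (rule linearI)
  have F': "((\<lambda>y. F y b) has_derivative frechet_derivative (\<lambda>y. F y b) (at x)) (at x)" for b
    using assms(4) frechet_derivative_works by blast
  show "frechet_derivative (\<lambda>y. F y (b + c)) (at x) z
      = frechet_derivative (\<lambda>y. F y b) (at x) z + frechet_derivative (\<lambda>y. F y c) (at x) z" for b c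
    by (rule fun_cong[OF has_derivative_unique[OF F'
          has_derivative_transform_within_open[OF has_derivative_add[OF F' F'] assms(1,2)]]])
      (simp add: linear_add[OF assms(3)])
  show "frechet_derivative (\<lambda>y. F y (r *\<^sub>R b)) (at x) z = r *\<^sub>R frechet_derivative (\<lambda>y. F y b) (at x) z" for r b
    by (rule fun_cong[OF has_derivative_unique[OF F'
          has_derivative_transform_within_open[OF has_derivative_scaleR_right[OF F'] assms(1,2)]]])
      (simp add: linear_scale[OF assms(3)])
qed

subsection \<open>Levi-Civita connection and curvature in a coordinate domain\<close>

text \<open>Tensors appear as multilinear maps instead of index arrays. The connection is given by
  \<open>\<Gamma>\<close>, which is pinned down by the Koszul formula for constant vector fields,
  whose brackets vanish.\<close>

locale metric_chart =
  fixes S :: "'e::euclidean_space set"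
    and g :: "'e \<Rightarrow> 'e \<Rightarrow> 'e \<Rightarrow> real"
    and \<Gamma> :: "'e \<Rightarrow> 'e \<Rightarrow> 'e \<Rightarrow> 'e"
  assumes open_S: "open S"
    and bilinear_g: "bilinear (g x)"
    and g_sym: "x \<in> S \<Longrightarrow> g x u v = g x v u"
    and g_nondeg: "x \<in> S \<Longrightarrow> (\<And>w. g x v w = 0) \<Longrightarrow> v = 0"
    and smooth_g: "smooth_on S (\<lambda>y. g y u v)"
    and bilinear_\<Gamma>: "bilinear (\<Gamma> x)"
    and smooth_\<Gamma>: "smooth_on S (\<lambda>y. \<Gamma> y u v)"
    and koszul: "x \<in> S \<Longrightarrow> 2 * g x (\<Gamma> x u v) w
      = frechet_derivative (\<lambda>y. g y v w) (at x) u + frechet_derivative (\<lambda>y. g y u w) (at x) v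
        - frechet_derivative (\<lambda>y. g y u v) (at x) w"
begin

definition dg :: "'e \<Rightarrow> 'e \<Rightarrow> 'e \<Rightarrow> 'e \<Rightarrow> real" where
  "dg x z u v = frechet_derivative (\<lambda>y. g y u v) (at x) z"

definition d\<Gamma> :: "'e \<Rightarrow> 'e \<Rightarrow> 'e \<Rightarrow> 'e \<Rightarrow> 'e" where
  "d\<Gamma> x z u v = frechet_derivative (\<lambda>y. \<Gamma> y u v) (at x) z"

text \<open>The commutator of covariant derivatives along the constant fields \<open>u\<close> and
  \<open>v\<close>, applied to the constant field \<open>w\<close>.\<close>

definition R :: "'e \<Rightarrow> 'e \<Rightarrow> 'e \<Rightarrow> 'e \<Rightarrow> 'e" where
  "R x u v w = d\<Gamma> x u v w - d\<Gamma> x v u w + \<Gamma> x u (\<Gamma> x v w) - \<Gamma> x v (\<Gamma> x u w)"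

definition dR :: "'e \<Rightarrow> 'e \<Rightarrow> 'e \<Rightarrow> 'e \<Rightarrow> 'e \<Rightarrow> 'e" where
  "dR x z u v w = frechet_derivative (\<lambda>y. R y u v w) (at x) z"

definition nabla_R :: "'e \<Rightarrow> 'e \<Rightarrow> 'e \<Rightarrow> 'e \<Rightarrow> 'e \<Rightarrow> 'e" where
  "nabla_R x z u v w = dR x z u v w + \<Gamma> x z (R x u v w)
     - R x (\<Gamma> x z u) v w - R x u (\<Gamma> x z v) w - R x u v (\<Gamma> x z w)"

lemmas g_simps = bilinear_ladd[OF bilinear_g] bilinear_radd[OF bilinear_g]
  bilinear_lsub[OF bilinear_g] bilinear_rsub[OF bilinear_g]
  bilinear_lneg[OF bilinear_g] bilinear_rneg[OF bilinear_g]

lemmas \<Gamma>_simps = bilinear_ladd[OF bilinear_\<Gamma>] bilinear_radd[OF bilinear_\<Gamma>]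
  bilinear_lsub[OF bilinear_\<Gamma>] bilinear_rsub[OF bilinear_\<Gamma>]
  bilinear_lneg[OF bilinear_\<Gamma>] bilinear_rneg[OF bilinear_\<Gamma>]

lemma linear_g: "linear (\<lambda>u. g x u v)" "linear (\<lambda>v. g x u v)"
  using bilinear_g[of x] by (auto simp: bilinear_def)

lemma linear_\<Gamma>: "linear (\<lambda>u. \<Gamma> x u v)" "linear (\<lambda>v. \<Gamma> x u v)"
  using bilinear_\<Gamma>[of x] by (auto simp: bilinear_def)

lemma has_derivative_g:
  "x \<in> S \<Longrightarrow> ((\<lambda>y. g y u v) has_derivative (\<lambda>z. dg x z u v)) (at x)"
  unfolding dg_def by (rule smooth_on_has_derivative[OF smooth_g])

lemma has_derivative_\<Gamma>:
  "x \<in> S \<Longrightarrow> ((\<lambda>y. \<Gamma> y u v) has_derivative (\<lambda>z. d\<Gamma> x z u v)) (at x)"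
  unfolding d\<Gamma>_def by (rule smooth_on_has_derivative[OF smooth_\<Gamma>])

lemma linear_d\<Gamma>:
  assumes "x \<in> S"
  shows "linear (\<lambda>z. d\<Gamma> x z u v)" "linear (\<lambda>u. d\<Gamma> x z u v)" "linear (\<lambda>v. d\<Gamma> x z u v)"
  unfolding d\<Gamma>_def
  by (rule linear_frechet_derivative[OF smooth_on_differentiable[OF smooth_\<Gamma> assms]]
      linear_frechet_derivative_slot[OF open_S assms _ smooth_on_differentiable[OF smooth_\<Gamma> assms]]
      linear_\<Gamma>)+

lemma dg_sym: "x \<in> S \<Longrightarrow> dg x z u v = dg x z v u"
  unfolding dg_def
  by (rule fun_cong[OF frechet_derivative_transform_within_open[OF _ open_S]])
    (simp_all add: g_sym smooth_on_differentiable[OF smooth_g])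

lemma g_eqI:
  assumes "x \<in> S" "\<And>w. g x u w = g x v w"
  shows "u = v"
  using g_nondeg[OF assms(1), of "u - v"] assms(2) by (simp add: g_simps)

text \<open>Torsion-freeness: the right-hand side of the Koszul formula is symmetric in
  \<open>u\<close> and \<open>v\<close>, and nondegeneracy removes the test vector.\<close>

lemma \<Gamma>_sym:
  assumes "x \<in> S"
  shows "\<Gamma> x u v = \<Gamma> x v u"
proof (rule g_eqI[OF assms])
  fix w
  show "g x (\<Gamma> x u v) w = g x (\<Gamma> x v u) w"
    using koszul[OF assms, of u v w] koszul[OF assms, of v u w] dg_sym[OF assms, of w u v]
    unfolding dg_def by simp
qed

lemma d\<Gamma>_sym: "x \<in> S \<Longrightarrow> d\<Gamma> x z u v = d\<Gamma> x z v u"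
  unfolding d\<Gamma>_def
  by (rule fun_cong[OF frechet_derivative_transform_within_open[OF _ open_S]])
    (simp_all add: \<Gamma>_sym smooth_on_differentiable[OF smooth_\<Gamma>])

text \<open>In the sum of the Koszul formulas for \<open>z u v\<close> and \<open>z v u\<close>
  everything cancels except twice the derivative along \<open>z\<close>.\<close>

lemma metric_compatible:
  assumes "x \<in> S"
  shows "dg x z u v = g x (\<Gamma> x z u) v + g x u (\<Gamma> x z v)"
  using koszul[OF assms, of z u v] koszul[OF assms, of z v u] g_sym[OF assms, of u "\<Gamma> x z v"]
    dg_sym[OF assms, of z u v] dg_sym[OF assms, of v z u] dg_sym[OF assms, of u z v]
  unfolding dg_def by simp

lemma smooth_\<Gamma>_\<Gamma>: "smooth_on S (\<lambda>y. \<Gamma> y u (\<Gamma> y v w))"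
proof -
  have "smooth_on S (\<lambda>y. \<Sum>i\<in>Basis. (\<Gamma> y v w \<bullet> i) *\<^sub>R \<Gamma> y u i)"
    by (intro smooth_on_sum smooth_on_scaleR smooth_on_inner_left smooth_\<Gamma> open_S)
  moreover have "(\<Sum>i\<in>Basis. (\<Gamma> y v w \<bullet> i) *\<^sub>R \<Gamma> y u i) = \<Gamma> y u (\<Gamma> y v w)" for y
  proof -
    have "\<Gamma> y u (\<Sum>i\<in>Basis. (\<Gamma> y v w \<bullet> i) *\<^sub>R i) = (\<Sum>i\<in>Basis. (\<Gamma> y v w \<bullet> i) *\<^sub>R \<Gamma> y u i)"
      by (simp add: linear_sum[OF linear_\<Gamma>(2)] linear_scale[OF linear_\<Gamma>(2)])
    then show ?thesis by (simp add: euclidean_representation)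
  qed
  ultimately show ?thesis by simp
qed

section \<open>The curvature as a smooth tensor field\<close>

lemma smooth_R: "smooth_on S (\<lambda>y. R y u v w)"
  unfolding R_def d\<Gamma>_def
  by (intro smooth_on_diff smooth_on_add smooth_on_frechet_derivative smooth_\<Gamma> smooth_\<Gamma>_\<Gamma> open_S)

lemma has_derivative_R:
  "x \<in> S \<Longrightarrow> ((\<lambda>y. R y u v w) has_derivative (\<lambda>z. dR x z u v w)) (at x)"
  unfolding dR_def by (rule smooth_on_has_derivative[OF smooth_R])

lemma linear_R:
  assumes "x \<in> S"
  shows "linear (\<lambda>u. R x u v w)" "linear (\<lambda>v. R x u v w)" "linear (\<lambda>w. R x u v w)"
  unfolding R_def
  using linear_d\<Gamma>[OF assms, THEN linear_add] linear_d\<Gamma>[OF assms, THEN linear_scale]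
    linear_\<Gamma>[of x, THEN linear_add] linear_\<Gamma>[of x, THEN linear_scale]
  by (auto intro!: linearI simp: algebra_simps)

lemma R_simps:
  assumes "x \<in> S"
  shows "R x (a + b) v w = R x a v w + R x b v w" "R x u (a + b) w = R x u a w + R x u b w"
    "R x u v (a + b) = R x u v a + R x u v b"
    "R x (a - b) v w = R x a v w - R x b v w" "R x u (a - b) w = R x u a w - R x u b w"
    "R x u v (a - b) = R x u v a - R x u v b"
    "R x (- a) v w = - R x a v w" "R x u (- a) w = - R x u a w" "R x u v (- a) = - R x u v a"
  using linear_R[OF assms, THEN linear_add] linear_R[OF assms, THEN linear_diff]
    linear_R[OF assms, THEN linear_neg] by auto

lemma linear_dR:
  assumes "x \<in> S"
  shows "linear (\<lambda>z. dR x z u v w)"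
  unfolding dR_def by (rule linear_frechet_derivative[OF smooth_on_differentiable[OF smooth_R assms]])

section \<open>Algebraic symmetries of the curvature\<close>

lemma R_antisym: "R x u v w = - R x v u w"
  by (simp add: R_def)

text \<open>Both the derivative terms and the quadratic terms cancel in pairs by symmetry of
  \<open>\<Gamma>\<close> in its lower slots.\<close>

lemma bianchi: "x \<in> S \<Longrightarrow> R x u v w + R x v w u + R x w u v = 0"
  by (simp add: R_def d\<Gamma>_sym[of x u w v] d\<Gamma>_sym[of x v w u] d\<Gamma>_sym[of x w v u]
      \<Gamma>_sym[of x w v] \<Gamma>_sym[of x w u] \<Gamma>_sym[of x v u])

text \<open>The second derivatives of the function \<open>g y w z\<close> along \<open>u\<close> and
  \<open>v\<close> commute; metric compatibility, used twice, expresses them through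
  \<open>\<Gamma>\<close>.\<close>

lemma R_skew:
  assumes x: "x \<in> S"
  shows "g x (R x u v w) z = - g x (R x u v z) w"
proof -
  have second: "frechet_derivative (\<lambda>y. frechet_derivative (\<lambda>y. g y w z) (at y) v) (at x) u
      = g x (\<Gamma> x u (\<Gamma> x v w)) z + g x (\<Gamma> x v w) (\<Gamma> x u z) + g x (d\<Gamma> x u v w) z
        + g x (\<Gamma> x u w) (\<Gamma> x v z) + g x w (\<Gamma> x u (\<Gamma> x v z)) + g x w (d\<Gamma> x u v z)" for u v
  proof -
    have 1: "((\<lambda>y. g y (\<Gamma> y v w) z) has_derivative
        (\<lambda>u. dg x u (\<Gamma> x v w) z + g x (d\<Gamma> x u v w) z)) (at x)"
      by (rule has_derivative_linear_slot[where F="\<lambda>y a. g y a z", OF open_S x linear_g(1)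
            has_derivative_g[OF x] has_derivative_\<Gamma>[OF x]])
    have 2: "((\<lambda>y. g y w (\<Gamma> y v z)) has_derivative
        (\<lambda>u. dg x u w (\<Gamma> x v z) + g x w (d\<Gamma> x u v z))) (at x)"
      by (rule has_derivative_linear_slot[where F="\<lambda>y a. g y w a", OF open_S x linear_g(2)
            has_derivative_g[OF x] has_derivative_\<Gamma>[OF x]])
    have "((\<lambda>y. frechet_derivative (\<lambda>y. g y w z) (at y) v) has_derivative
        (\<lambda>u. (dg x u (\<Gamma> x v w) z + g x (d\<Gamma> x u v w) z) + (dg x u w (\<Gamma> x v z) + g x w (d\<Gamma> x u v z)))) (at x)"
      by (rule has_derivative_transform_within_open[OF has_derivative_add[OF 1 2] open_S x])
        (simp add: metric_compatible[symmetric], simp add: dg_def)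
    from fun_cong[OF frechet_derivative_at[OF this], of u] show ?thesis
      by (simp add: metric_compatible[OF x])
  qed
  \<comment> \<open>The products pairing \<open>\<Gamma>\<close> applied to \<open>w\<close> with
    \<open>\<Gamma>\<close> applied to \<open>z\<close> are together symmetric in \<open>u\<close>
    and \<open>v\<close>, so they drop out of the difference.\<close>
  have "g x (R x u v w) z + g x w (R x u v z) = 0"
    using second_derivative_symmetric[OF open_S smooth_g x, of w z v u]
    unfolding second by (simp add: R_def g_simps)
  then show ?thesis using g_sym[OF x, of w] by simp
qed

text \<open>The classical combination: the Bianchi identity for the four cyclic shifts of
  \<open>u v w z\<close>, simplified with the antisymmetry in the first and in the last
  pair.\<close>

lemma R_pair_sym:
  assumes x: "x \<in> S"
  shows "g x (R x u v w) z = g x (R x w z u) v"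
proof -
  define A where "A a b c d = g x (R x a b c) d" for a b c d
  have anti: "A a b c d = - A b a c d" for a b c d
    unfolding A_def by (subst R_antisym) (simp add: g_simps)
  have skew: "A a b c d = - A a b d c" for a b c d
    unfolding A_def by (rule R_skew[OF x])
  have bi: "A a b c d + A b c a d + A c a b d = 0" for a b c d
    using arg_cong[OF bianchi[OF x, of a b c], of "\<lambda>t. g x t d"] linear_0[OF linear_g(1), of x d]
    by (simp add: A_def g_simps)
  have "A u v w z = A w z u v"
    using bi[of u v w z] bi[of v w z u] bi[of w z u v] bi[of z u v w]
      anti[of w u v z] skew[of v w z u] skew[of w z v u] anti[of z v w u] skew[of v z w u]
      anti[of z u w v] skew[of u w z v] anti[of z u v w] skew[of u v z w] skew[of u z v w] skew[of z v w u]
    by linarith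
  then show ?thesis by (simp add: A_def)
qed

text \<open>Differentiating \<open>nabla_R = 0\<close> and antisymmetrizing eliminates the second derivatives of \<open>R\<close>.\<close>

lemma ricci:
  assumes parallel: "\<And>y z u v w. y \<in> S \<Longrightarrow> nabla_R y z u v w = 0" and x: "x \<in> S"
  shows "R x y z (R x u v w) = R x (R x y z u) v w + R x u (R x y z v) w + R x u v (R x y z w)"
proof -
  have first: "dR y z u v w = R y (\<Gamma> y z u) v w + R y u (\<Gamma> y z v) w + R y u v (\<Gamma> y z w) - \<Gamma> y z (R y u v w)"
    if "y \<in> S" for y z u v w
    using parallel[OF that, of z u v w] by (simp add: nabla_R_def algebra_simps)
  have second: "frechet_derivative (\<lambda>p. frechet_derivative (\<lambda>p. R p u v w) (at p) z) (at x) y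
    = (dR x y (\<Gamma> x z u) v w + R x (d\<Gamma> x y z u) v w)
      + (dR x y u (\<Gamma> x z v) w + R x u (d\<Gamma> x y z v) w)
      + (dR x y u v (\<Gamma> x z w) + R x u v (d\<Gamma> x y z w))
      - (d\<Gamma> x y z (R x u v w) + \<Gamma> x z (dR x y u v w))" for y z
  proof -
    have 1: "((\<lambda>p. R p (\<Gamma> p z u) v w) has_derivative
        (\<lambda>y. dR x y (\<Gamma> x z u) v w + R x (d\<Gamma> x y z u) v w)) (at x)"
      by (rule has_derivative_linear_slot[where F="\<lambda>p a. R p a v w", OF open_S x linear_R(1)
            has_derivative_R[OF x] has_derivative_\<Gamma>[OF x]])
    have 2: "((\<lambda>p. R p u (\<Gamma> p z v) w) has_derivative
        (\<lambda>y. dR x y u (\<Gamma> x z v) w + R x u (d\<Gamma> x y z v) w)) (at x)"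
      by (rule has_derivative_linear_slot[where F="\<lambda>p a. R p u a w", OF open_S x linear_R(2)
            has_derivative_R[OF x] has_derivative_\<Gamma>[OF x]])
    have 3: "((\<lambda>p. R p u v (\<Gamma> p z w)) has_derivative
        (\<lambda>y. dR x y u v (\<Gamma> x z w) + R x u v (d\<Gamma> x y z w))) (at x)"
      by (rule has_derivative_linear_slot[where F="\<lambda>p a. R p u v a", OF open_S x linear_R(3)
            has_derivative_R[OF x] has_derivative_\<Gamma>[OF x]])
    have 4: "((\<lambda>p. \<Gamma> p z (R p u v w)) has_derivative
        (\<lambda>y. d\<Gamma> x y z (R x u v w) + \<Gamma> x z (dR x y u v w))) (at x)"
      by (rule has_derivative_linear_slot[where F="\<lambda>p a. \<Gamma> p z a", OF open_S x linear_\<Gamma>(2)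
            has_derivative_\<Gamma>[OF x] has_derivative_R[OF x]])
    show ?thesis
      by (rule fun_cong[OF frechet_derivative_at[symmetric], OF has_derivative_transform_within_open[OF
              has_derivative_diff[OF has_derivative_add[OF has_derivative_add[OF 1 2] 3] 4] open_S x]])
        (simp add: first[symmetric], simp add: dR_def)
  qed
  \<comment> \<open>First derivatives of \<open>R\<close> still occur in \<open>second\<close>;
    replacing them by \<open>first\<close> once more leaves \<open>R\<close>,
    \<open>\<Gamma>\<close> and \<open>d\<Gamma>\<close> only, and these group into the curvature
    operator \<open>R x y z\<close>.\<close>
  have "R x (R x y z u) v w + R x u (R x y z v) w + R x u v (R x y z w) - R x y z (R x u v w) = 0"
    using second_derivative_symmetric[OF open_S smooth_R x, of u v w z y]
    unfolding second first[OF x] R_def[of x y z]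
    by (simp add: R_simps[OF x] \<Gamma>_simps \<Gamma>_sym[OF x, of z y] algebra_simps)
  then show ?thesis by simp
qed

end

subsection \<open>Local isometries\<close>

text \<open>Covers two situations: the transition map between two charts, and the reflection
  \<open>uminus\<close> of a single coordinate domain.\<close>

locale local_isometry =
  A: metric_chart S g \<Gamma> + B: metric_chart S' g' \<Gamma>'
  for S :: "'e::euclidean_space set" and g \<Gamma> and S' :: "'e set" and g' \<Gamma>' +
  fixes V :: "'e set" and \<phi> :: "'e \<Rightarrow> 'e"
  assumes open_V: "open V" and V_subset: "V \<subseteq> S" and \<phi>_V: "\<phi> ` V \<subseteq> S'"
    and smooth_\<phi>: "smooth_on V \<phi>"
    and isometry: "x \<in> V \<Longrightarrow>
      g' (\<phi> x) (frechet_derivative \<phi> (at x) u) (frechet_derivative \<phi> (at x) v) = g x u v"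
begin

text \<open>\<open>P\<close>, \<open>P2\<close> and \<open>P3\<close> are the successive derivatives
  of \<open>\<phi>\<close>; the most recent direction of differentiation comes first.\<close>

definition P :: "'e \<Rightarrow> 'e \<Rightarrow> 'e" where
  "P x u = frechet_derivative \<phi> (at x) u"

definition P2 :: "'e \<Rightarrow> 'e \<Rightarrow> 'e \<Rightarrow> 'e" where
  "P2 x z u = frechet_derivative (\<lambda>y. P y u) (at x) z"

definition P3 :: "'e \<Rightarrow> 'e \<Rightarrow> 'e \<Rightarrow> 'e \<Rightarrow> 'e" where
  "P3 x y z u = frechet_derivative (\<lambda>p. P2 p z u) (at x) y"

lemma in_S: "x \<in> V \<Longrightarrow> x \<in> S" "x \<in> V \<Longrightarrow> \<phi> x \<in> S'"
  using V_subset \<phi>_V by auto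

lemma isometry_P: "x \<in> V \<Longrightarrow> g' (\<phi> x) (P x u) (P x v) = g x u v"
  unfolding P_def by (rule isometry)

lemma smooth_P: "smooth_on V (\<lambda>y. P y u)"
  unfolding P_def by (rule smooth_on_frechet_derivative[OF smooth_\<phi>])

lemma smooth_P2: "smooth_on V (\<lambda>y. P2 y z u)"
  unfolding P2_def by (rule smooth_on_frechet_derivative[OF smooth_P])

lemma has_derivative_\<phi>: "x \<in> V \<Longrightarrow> (\<phi> has_derivative P x) (at x)"
  unfolding P_def by (rule smooth_on_has_derivative[OF smooth_\<phi>])

lemma has_derivative_P: "x \<in> V \<Longrightarrow> ((\<lambda>y. P y u) has_derivative (\<lambda>z. P2 x z u)) (at x)"
  unfolding P2_def by (rule smooth_on_has_derivative[OF smooth_P])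

lemma has_derivative_P2: "x \<in> V \<Longrightarrow> ((\<lambda>p. P2 p z u) has_derivative (\<lambda>y. P3 x y z u)) (at x)"
  unfolding P3_def by (rule smooth_on_has_derivative[OF smooth_P2])

lemma linear_P: "x \<in> V \<Longrightarrow> linear (P x)"
  using has_derivative_\<phi> has_derivative_linear by blast

lemma P2_sym: "x \<in> V \<Longrightarrow> P2 x u v = P2 x v u"
  unfolding P2_def P_def by (rule second_derivative_symmetric[OF open_V smooth_\<phi>])

lemma P3_sym: "x \<in> V \<Longrightarrow> P3 x y z u = P3 x z y u"
  unfolding P3_def P2_def by (rule second_derivative_symmetric[OF open_V smooth_P])

lemma P_simps:
  assumes "x \<in> V"
  shows "P x (a + b) = P x a + P x b" "P x (a - b) = P x a - P x b" "P x (- a) = - P x a"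
  using linear_P[OF assms] by (simp_all add: linear_add linear_diff linear_neg)

text \<open>Injectivity comes from nondegeneracy, because an indefinite metric offers no norm to
  compare.\<close>

lemma P_eq_0:
  assumes "x \<in> V" "P x u = 0"
  shows "u = 0"
  using A.g_nondeg[OF in_S(1)[OF assms(1)], of u] isometry_P[OF assms(1), of u] assms(2)
    linear_0[OF B.linear_g(1)] by simp

lemma P_surj:
  assumes "x \<in> V"
  obtains u where "P x u = w"
proof -
  have "inj (P x)"
    using P_eq_0[OF assms] linear_injective_0[OF linear_P[OF assms]] by blast
  then have "surj (P x)" by (rule linear_injective_imp_surjective[OF linear_P[OF assms]]) (rule refl)
  then show ?thesis using that by (metis surjD)
qed

section \<open>Transformation laws of the connection and the curvature\<close>

lemma dg_pullback:
  assumes x: "x \<in> V"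
  shows "A.dg x z u v = B.dg (\<phi> x) (P x z) (P x u) (P x v)
    + g' (\<phi> x) (P2 x z u) (P x v) + g' (\<phi> x) (P x u) (P2 x z v)"
proof -
  have "((\<lambda>y. g' (\<phi> y) (P y u) (P y v)) has_derivative
      (\<lambda>z. B.dg (\<phi> x) (P x z) (P x u) (P x v)
        + g' (\<phi> x) (P2 x z u) (P x v) + g' (\<phi> x) (P x u) (P2 x z v))) (at x)"
    by (rule has_derivative_linear_slot2[where F="\<lambda>y. g' (\<phi> y)", OF open_V x B.linear_g
          has_derivative_compose[OF has_derivative_\<phi>[OF x] B.has_derivative_g[OF in_S(2)[OF x]]]
          has_derivative_P[OF x] has_derivative_P[OF x]])
  from has_derivative_transform_within_open[OF this open_V x isometry_P]
  show ?thesis by (rule fun_cong[OF has_derivative_unique[OF A.has_derivative_g[OF in_S(1)[OF x]]]])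
qed

text \<open>The Koszul formula on both sides is compared through \<open>dg_pullback\<close>. Of its
  six terms with second derivatives of \<open>\<phi>\<close>, four cancel by symmetry of
  \<open>P2\<close> and two add up to the inhomogeneous term.\<close>

lemma \<Gamma>_pullback:
  assumes x: "x \<in> V"
  shows "P x (\<Gamma> x u v) = P2 x u v + \<Gamma>' (\<phi> x) (P x u) (P x v)"
proof (rule B.g_eqI[OF in_S(2)[OF x]])
  fix w'
  \<comment> \<open>By surjectivity of \<open>P x\<close> every test vector in the target is the
    image of one in the source.\<close>
  obtain w where w: "P x w = w'" using P_surj[OF x] .
  have "2 * g x (\<Gamma> x u v) w = A.dg x u v w + A.dg x v u w - A.dg x w u v"
    unfolding A.dg_def by (rule A.koszul[OF in_S(1)[OF x]])
  moreover have "2 * g' (\<phi> x) (\<Gamma>' (\<phi> x) (P x u) (P x v)) (P x w)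
      = B.dg (\<phi> x) (P x u) (P x v) (P x w) + B.dg (\<phi> x) (P x v) (P x u) (P x w)
        - B.dg (\<phi> x) (P x w) (P x u) (P x v)"
    unfolding B.dg_def by (rule B.koszul[OF in_S(2)[OF x]])
  ultimately have "g x (\<Gamma> x u v) w = g' (\<phi> x) (P2 x u v + \<Gamma>' (\<phi> x) (P x u) (P x v)) (P x w)"
    by (simp add: dg_pullback[OF x] B.g_simps P2_sym[OF x, of v u] P2_sym[OF x, of w u] P2_sym[OF x, of w v]
        B.g_sym[OF in_S(2)[OF x], of "P2 x u w" "P x v"] B.g_sym[OF in_S(2)[OF x], of "P x u" "P2 x v w"])
  then show "g' (\<phi> x) (P x (\<Gamma> x u v)) w' = g' (\<phi> x) (P2 x u v + \<Gamma>' (\<phi> x) (P x u) (P x v)) w'"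
    by (simp add: isometry_P[OF x] flip: w)
qed

text \<open>Differentiating the law for \<open>\<Gamma>\<close> and antisymmetrizing removes the
  third derivatives by symmetry of \<open>P3\<close>, and all \<open>P2\<close> terms cancel, so
  \<open>R\<close> is tensorial.\<close>

lemma R_pullback:
  assumes x: "x \<in> V"
  shows "P x (A.R x z u v) = B.R (\<phi> x) (P x z) (P x u) (P x v)"
proof -
  have d\<Gamma>: "P x (A.d\<Gamma> x z u v) = P3 x z u v + B.d\<Gamma> (\<phi> x) (P x z) (P x u) (P x v)
      + \<Gamma>' (\<phi> x) (P2 x z u) (P x v) + \<Gamma>' (\<phi> x) (P x u) (P2 x z v) - P2 x z (\<Gamma> x u v)" for z u
  proof -
    have 1: "((\<lambda>y. P y (\<Gamma> y u v)) has_derivative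
        (\<lambda>z. P2 x z (\<Gamma> x u v) + P x (A.d\<Gamma> x z u v))) (at x)"
      by (rule has_derivative_linear_slot[OF open_V x linear_P has_derivative_P[OF x]
            A.has_derivative_\<Gamma>[OF in_S(1)[OF x]]])
    have 2: "((\<lambda>y. \<Gamma>' (\<phi> y) (P y u) (P y v)) has_derivative
      (\<lambda>z. B.d\<Gamma> (\<phi> x) (P x z) (P x u) (P x v)
        + \<Gamma>' (\<phi> x) (P2 x z u) (P x v) + \<Gamma>' (\<phi> x) (P x u) (P2 x z v))) (at x)"
      by (rule has_derivative_linear_slot2[where F="\<lambda>y. \<Gamma>' (\<phi> y)", OF open_V x B.linear_\<Gamma>
            has_derivative_compose[OF has_derivative_\<phi>[OF x] B.has_derivative_\<Gamma>[OF in_S(2)[OF x]]]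
            has_derivative_P[OF x] has_derivative_P[OF x]])
    have "P2 x z (\<Gamma> x u v) + P x (A.d\<Gamma> x z u v) = P3 x z u v + (B.d\<Gamma> (\<phi> x) (P x z) (P x u) (P x v)
        + \<Gamma>' (\<phi> x) (P2 x z u) (P x v) + \<Gamma>' (\<phi> x) (P x u) (P2 x z v))"
      by (rule fun_cong[OF has_derivative_unique[OF 1 has_derivative_transform_within_open[OF
              has_derivative_add[OF has_derivative_P2[OF x] 2] open_V x]]])
        (simp add: \<Gamma>_pullback)
    then show ?thesis by (simp add: algebra_simps)
  qed
  show ?thesis
    unfolding A.R_def B.R_def P_simps[OF x] d\<Gamma> \<Gamma>_pullback[OF x] B.\<Gamma>_simps
    by (simp add: P3_sym[OF x, of z u] P2_sym[OF x, of z u])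
qed

text \<open>Where \<open>\<Gamma>'\<close> vanishes, the law for \<open>\<Gamma>\<close> identifies
  \<open>P2\<close> with \<open>P x\<close> applied to \<open>\<Gamma>\<close>. Differentiating
  \<open>R_pullback\<close> then produces exactly the correction terms in
  \<open>nabla_R\<close>.\<close>

lemma nabla_R_pullback_0:
  assumes x: "x \<in> V"
    and "\<And>u v. \<Gamma>' (\<phi> x) u v = 0" "\<And>z u v w. B.dR (\<phi> x) z u v w = 0"
  shows "A.nabla_R x z u v w = 0"
proof -
  have \<Gamma>: "P2 x a b = P x (\<Gamma> x a b)" for a b
    using \<Gamma>_pullback[OF x] assms(2) by simp
  have 1: "((\<lambda>y. P y (A.R y u v w)) has_derivative
      (\<lambda>z. P2 x z (A.R x u v w) + P x (A.dR x z u v w))) (at x)"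
    by (rule has_derivative_linear_slot[OF open_V x linear_P has_derivative_P[OF x]
          A.has_derivative_R[OF in_S(1)[OF x]]])
  have 2: "((\<lambda>y. B.R (\<phi> y) (P y u) (P y v) (P y w)) has_derivative
      (\<lambda>z. B.dR (\<phi> x) (P x z) (P x u) (P x v) (P x w) + B.R (\<phi> x) (P2 x z u) (P x v) (P x w)
        + B.R (\<phi> x) (P x u) (P2 x z v) (P x w) + B.R (\<phi> x) (P x u) (P x v) (P2 x z w))) (at x)"
    by (rule has_derivative_linear_slot3[where F="\<lambda>y. B.R (\<phi> y)", OF open_V x
          B.linear_R[OF in_S(2)]
          has_derivative_compose[OF has_derivative_\<phi>[OF x] B.has_derivative_R[OF in_S(2)[OF x]]]
          has_derivative_P[OF x] has_derivative_P[OF x] has_derivative_P[OF x]])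
  have "P2 x z (A.R x u v w) + P x (A.dR x z u v w)
      = B.dR (\<phi> x) (P x z) (P x u) (P x v) (P x w) + B.R (\<phi> x) (P2 x z u) (P x v) (P x w)
        + B.R (\<phi> x) (P x u) (P2 x z v) (P x w) + B.R (\<phi> x) (P x u) (P x v) (P2 x z w)"
    by (rule fun_cong[OF has_derivative_unique[OF 1 has_derivative_transform_within_open[OF 2 open_V x]]])
      (simp add: R_pullback)
  then have "P x (A.nabla_R x z u v w) = 0"
    unfolding \<Gamma> assms(3) R_pullback[OF x, symmetric] A.nabla_R_def P_simps[OF x]
    by (simp add: algebra_simps)
  then show ?thesis by (rule P_eq_0[OF x])
qed

end

section \<open>Metrics invariant under the reflection at the origin\<close>

context metric_chart
begin

text \<open>The reflection is an isometry with derivative -1 and vanishing second derivative. It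
  fixes the origin, and a tensor with an odd number of slots changes sign there; this applies to
  \<open>\<Gamma>\<close> and to the derivative of \<open>R\<close>.\<close>

lemma even_metric:
  assumes "0 \<in> S" "uminus ` S = S" and even: "\<And>x u v. x \<in> S \<Longrightarrow> g (- x) u v = g x u v"
  shows "\<Gamma> 0 u v = 0" "dR 0 z u v w = 0"
proof -
  have D: "frechet_derivative uminus (at x) u = - u" for x u :: 'e
    using fun_cong[OF frechet_derivative_at[OF has_derivative_minus[OF has_derivative_ident]]] by metis
  have smooth: "smooth_on S (uminus :: 'e \<Rightarrow> 'e)"
    unfolding smooth_on_def
  proof
    \<comment> \<open>The derivative of \<open>uminus\<close> is constant, so a case distinction on
      \<open>k\<close> suffices.\<close>
    show "Ck_on k S (uminus :: 'e \<Rightarrow> 'e)" for k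
      by (cases k) (auto simp: D Ck_on_const continuous_intros
          intro!: differentiableI[OF has_derivative_minus[OF has_derivative_ident]])
  qed
  interpret local_isometry S g \<Gamma> S g \<Gamma> S uminus
    using open_S assms(2) smooth even by unfold_locales (auto simp: D g_simps)
  have P: "P x u = - u" for x u by (simp add: P_def D)
  have P2: "P2 x z u = 0" for x z u by (simp add: P2_def P)
  have "\<Gamma> 0 u v = - \<Gamma> 0 u v"
    using \<Gamma>_pullback[OF assms(1), of u v] by (simp add: P P2 \<Gamma>_simps)
  then have "\<Gamma> 0 u v + \<Gamma> 0 u v = 0" by (simp only: eq_neg_iff_add_eq_0)
  then show "\<Gamma> 0 u v = 0" by (simp flip: scaleR_2)
  \<comment> \<open>The three argument signs and the one of the value cancel; an even field has an
    odd derivative, which is zero at the origin.\<close>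
  have even_R: "R (- x) u v w = R x u v w" if "x \<in> S" for x
    using R_pullback[OF that, of u v w] R_simps[OF in_S(2)[OF that]] by (simp add: P)
  have "((\<lambda>y. R (- y) u v w) has_derivative (\<lambda>z. dR (- 0) (- z) u v w)) (at 0)"
    using assms(1) by (intro has_derivative_compose[OF has_derivative_minus[OF has_derivative_ident]])
      (simp add: has_derivative_R)
  from has_derivative_transform_within_open[OF this open_S assms(1) even_R]
  have "dR 0 z u v w = dR (- 0) (- z) u v w"
    by (rule fun_cong[OF has_derivative_unique[OF has_derivative_R[OF assms(1)]]])
  then have "dR 0 z u v w = dR 0 (- z) u v w" by simp
  also have "\<dots> = - dR 0 z u v w" by (rule linear_neg[OF linear_dR[OF assms(1)]])
  finally have "dR 0 z u v w + dR 0 z u v w = 0" by (simp only: eq_neg_iff_add_eq_0)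
  then show "dR 0 z u v w = 0" by (simp flip: scaleR_2)
qed

end

subsection \<open>Metric components\<close>

definition metric_form :: "(real ^ 'n \<Rightarrow> real ^ 'n ^ 'n) \<Rightarrow> real ^ 'n::finite \<Rightarrow> real ^ 'n \<Rightarrow> real ^ 'n \<Rightarrow> real" where
  "metric_form G x u v = u \<bullet> (G x *v v)"

definition christoffel_form :: "(real ^ 'n \<Rightarrow> real ^ 'n ^ 'n) \<Rightarrow> real ^ 'n::finite \<Rightarrow> real ^ 'n \<Rightarrow> real ^ 'n \<Rightarrow> real ^ 'n" where
  "christoffel_form G x u v = (\<chi> i. \<Sum>j\<in>UNIV. \<Sum>k\<in>UNIV. christoffel G x i j k * u $ j * v $ k)"

lemma metric_form_sum: "metric_form G x u v = (\<Sum>i\<in>UNIV. \<Sum>j\<in>UNIV. u $ i * v $ j * (G x $ i $ j))"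
  by (simp add: metric_form_def inner_vec_def matrix_vector_mult_def sum_distrib_left mult_ac)

lemma bilinear_metric_form: "bilinear (metric_form G x)"
  unfolding bilinear_def
  by (auto intro!: linearI simp: metric_form_def inner_add_left inner_add_right matrix_vector_right_distrib
      matrix_vector_mult_scaleR)

lemma bilinear_christoffel_form: "bilinear (christoffel_form G x)"
  unfolding bilinear_def
  by (auto intro!: linearI simp: christoffel_form_def vec_eq_iff sum.distrib sum_distrib_left algebra_simps)

text \<open>The conditions imposed on the metric components in one chart; they are turned into a
  \<open>metric_chart\<close> below.\<close>

locale semi_riemannian_domain =
  fixes S :: "(real ^ 'n::finite) set" and G :: "real ^ 'n \<Rightarrow> real ^ 'n ^ 'n"
  assumes open_dom: "open S"
    and smooth_G: "smooth_on S (\<lambda>x. G x $ i $ j)"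
    and G_sym: "x \<in> S \<Longrightarrow> v \<bullet> (G x *v w) = w \<bullet> (G x *v v)"
    and G_nondeg: "x \<in> S \<Longrightarrow> (\<And>w. v \<bullet> (G x *v w) = 0) \<Longrightarrow> v = 0"
begin

lemma invertible_G:
  assumes "x \<in> S"
  shows "invertible (G x)"
proof -
  have "v = 0" if "G x *v v = 0" for v
    using G_nondeg[OF assms, of v] G_sym[OF assms, of v] that by simp
  then show ?thesis
    unfolding invertible_left_inverse matrix_left_invertible_ker by blast
qed

lemma smooth_metric_form: "smooth_on S (\<lambda>x. metric_form G x u v)"
  unfolding metric_form_sum
  by (intro smooth_on_sum smooth_on_mult smooth_on_const smooth_G open_dom)

lemma smooth_christoffel: "smooth_on S (\<lambda>x. christoffel G x i j k)"
  unfolding christoffel_def Let_def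
  by (intro smooth_on_sum smooth_on_mult smooth_on_add smooth_on_diff smooth_on_const smooth_on_matrix_inv
      smooth_on_frechet_derivative smooth_G invertible_G open_dom)

lemma smooth_christoffel_form: "smooth_on S (\<lambda>x. christoffel_form G x u v)"
proof (rule smooth_on_vec[OF open_dom])
  show "smooth_on S (\<lambda>x. christoffel_form G x u v $ i)" for i
    unfolding christoffel_form_def vec_lambda_beta
    by (intro smooth_on_sum smooth_on_mult smooth_on_const smooth_christoffel open_dom)
qed

section \<open>The Koszul formula in components\<close>

definition dG :: "real ^ 'n \<Rightarrow> 'n \<Rightarrow> 'n \<Rightarrow> 'n \<Rightarrow> real" where
  "dG x l a b = frechet_derivative (\<lambda>y. G y $ a $ b) (at x) (axis l 1)"

lemma frechet_derivative_metric_form: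
  assumes "x \<in> S"
  shows "frechet_derivative (\<lambda>y. metric_form G y u v) (at x) z
    = (\<Sum>l\<in>UNIV. \<Sum>i\<in>UNIV. \<Sum>j\<in>UNIV. z $ l * u $ i * v $ j * dG x l i j)"
proof -
  have "((\<lambda>y. metric_form G y u v) has_derivative
      (\<lambda>z. \<Sum>i\<in>UNIV. \<Sum>j\<in>UNIV. u $ i * v $ j * frechet_derivative (\<lambda>y. G y $ i $ j) (at x) z)) (at x)"
    unfolding metric_form_sum
    by (intro has_derivative_sum has_derivative_mult_right smooth_on_has_derivative[OF smooth_G assms])
  from fun_cong[OF frechet_derivative_at[OF this], of z]
  have "frechet_derivative (\<lambda>y. metric_form G y u v) (at x) z
    = (\<Sum>i\<in>UNIV. \<Sum>j\<in>UNIV. u $ i * v $ j * frechet_derivative (\<lambda>y. G y $ i $ j) (at x) z)" by simp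
  also have "\<dots> = (\<Sum>i\<in>UNIV. \<Sum>j\<in>UNIV. \<Sum>l\<in>UNIV. z $ l * u $ i * v $ j * dG x l i j)"
  proof (intro sum.cong refl)
    fix i j
    have lin: "linear (frechet_derivative (\<lambda>y. G y $ i $ j) (at x))"
      by (rule linear_frechet_derivative[OF smooth_on_differentiable[OF smooth_G assms]])
    have "frechet_derivative (\<lambda>y. G y $ i $ j) (at x) z
        = frechet_derivative (\<lambda>y. G y $ i $ j) (at x) (\<Sum>l\<in>UNIV. (z $ l) *\<^sub>R axis l 1)"
      by (simp only: basis_expansion flip: scalar_mult_eq_scaleR)
    also have "\<dots> = (\<Sum>l\<in>UNIV. z $ l * dG x l i j)"
      unfolding dG_def linear_sum[OF lin] linear_scale[OF lin] by simp
    finally show "u $ i * v $ j * frechet_derivative (\<lambda>y. G y $ i $ j) (at x) z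
        = (\<Sum>l\<in>UNIV. z $ l * u $ i * v $ j * dG x l i j)"
      by (simp add: sum_distrib_left mult_ac)
  qed
  also have "\<dots> = (\<Sum>l\<in>UNIV. \<Sum>i\<in>UNIV. \<Sum>j\<in>UNIV. z $ l * u $ i * v $ j * dG x l i j)"
    by (subst sum.swap[of _ UNIV UNIV], subst (2) sum.swap[of _ UNIV UNIV], rule refl)
  finally show ?thesis .
qed

text \<open>Twice the Christoffel symbols of the first kind, contracted with \<open>u\<close> and
  \<open>v\<close>.\<close>

definition first_kind :: "real ^ 'n \<Rightarrow> real ^ 'n \<Rightarrow> real ^ 'n \<Rightarrow> real ^ 'n" where
  "first_kind x u v = (\<chi> l. \<Sum>j\<in>UNIV. \<Sum>k\<in>UNIV. u $ j * v $ k * (dG x j k l + dG x k j l - dG x l j k))"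

lemma christoffel_form_eq: "christoffel_form G x u v = (1/2) *\<^sub>R (matrix_inv (G x) *v first_kind x u v)"
proof (simp only: vec_eq_iff, rule allI)
  fix i
  let ?K = "\<lambda>j k l. dG x j k l + dG x k j l - dG x l j k" and ?I = "matrix_inv (G x)"
  have "christoffel_form G x u v $ i
      = (\<Sum>j\<in>UNIV. \<Sum>k\<in>UNIV. \<Sum>l\<in>UNIV. (1/2) * (?I $ i $ l * (u $ j * v $ k * ?K j k l)))"
    unfolding christoffel_form_def christoffel_def Let_def vec_lambda_beta dG_def
    by (intro sum.cong refl) (simp add: sum_distrib_left sum_distrib_right mult_ac)
  also have "\<dots> = (\<Sum>l\<in>UNIV. \<Sum>j\<in>UNIV. \<Sum>k\<in>UNIV. (1/2) * (?I $ i $ l * (u $ j * v $ k * ?K j k l)))"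
    by (subst (2) sum.swap[of _ UNIV UNIV], subst sum.swap[of _ UNIV UNIV], rule refl)
  also have "\<dots> = ((1/2) *\<^sub>R (?I *v first_kind x u v)) $ i"
    by (simp add: matrix_vector_mult_def first_kind_def sum_distrib_left)
  finally show "christoffel_form G x u v $ i = ((1/2) *\<^sub>R (?I *v first_kind x u v)) $ i" .
qed

lemma sum_swap3:
  fixes f :: "'n \<Rightarrow> 'n \<Rightarrow> 'n \<Rightarrow> real"
  shows "(\<Sum>l\<in>UNIV. \<Sum>j\<in>UNIV. \<Sum>k\<in>UNIV. f j k l) = (\<Sum>j\<in>UNIV. \<Sum>k\<in>UNIV. \<Sum>l\<in>UNIV. f j k l)"
  by (subst (2) sum.swap[of _ UNIV UNIV], subst sum.swap[of _ UNIV UNIV], rule refl)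

text \<open>Only the Koszul formula takes work: lowering the index of \<open>christoffel\<close>
  cancels the inverse matrix and the factor 1/2, which leaves \<open>first_kind\<close>.\<close>

sublocale metric_chart S "metric_form G" "christoffel_form G"
proof
  show "open S" by (rule open_dom)
  show "bilinear (metric_form G x)" "bilinear (christoffel_form G x)" for x
    by (rule bilinear_metric_form bilinear_christoffel_form)+
  show "metric_form G x u v = metric_form G x v u" if "x \<in> S" for x u v
    unfolding metric_form_def by (rule G_sym[OF that])
  show "v = 0" if "x \<in> S" "\<And>w. metric_form G x v w = 0" for x v
    using G_nondeg[OF that(1)] that(2) by (simp add: metric_form_def)
  show "smooth_on S (\<lambda>y. metric_form G y u v)" "smooth_on S (\<lambda>y. christoffel_form G y u v)" for u v
    by (rule smooth_metric_form smooth_christoffel_form)+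
  fix x u v w
  assume x: "x \<in> S"
  have "2 * metric_form G x (christoffel_form G x u v) w = 2 * (w \<bullet> (G x *v christoffel_form G x u v))"
    unfolding metric_form_def by (subst G_sym[OF x]) (rule refl)
  also have "\<dots> = w \<bullet> first_kind x u v"
    unfolding christoffel_form_eq
    by (simp add: matrix_vector_mult_scaleR matrix_vector_mul_assoc matrix_inv_inverse[OF invertible_G[OF x]])
  also have "\<dots> = (\<Sum>l\<in>UNIV. \<Sum>j\<in>UNIV. \<Sum>k\<in>UNIV.
      u $ j * v $ k * w $ l * dG x j k l + u $ j * v $ k * w $ l * dG x k j l - u $ j * v $ k * w $ l * dG x l j k)"
    by (simp add: inner_vec_def first_kind_def sum_distrib_left algebra_simps)
  also have "\<dots> = (\<Sum>j\<in>UNIV. \<Sum>k\<in>UNIV. \<Sum>l\<in>UNIV. u $ j * v $ k * w $ l * dG x j k l)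
      + (\<Sum>k\<in>UNIV. \<Sum>j\<in>UNIV. \<Sum>l\<in>UNIV. v $ k * u $ j * w $ l * dG x k j l)
      - (\<Sum>l\<in>UNIV. \<Sum>j\<in>UNIV. \<Sum>k\<in>UNIV. w $ l * u $ j * v $ k * dG x l j k)"
  \<comment> \<open>The sums are reordered so that the direction of differentiation is outermost, as
    in \<open>frechet_derivative_metric_form\<close>.\<close>
  proof -
    have "(\<Sum>k\<in>UNIV. \<Sum>j\<in>UNIV. \<Sum>l\<in>UNIV. v $ k * u $ j * w $ l * dG x k j l)
        = (\<Sum>j\<in>UNIV. \<Sum>k\<in>UNIV. \<Sum>l\<in>UNIV. u $ j * v $ k * w $ l * dG x k j l)"
      by (subst sum.swap) (simp add: mult_ac)
    then show ?thesis
      by (simp add: sum.distrib sum_subtractf sum_swap3[of "\<lambda>j k l. u $ j * v $ k * w $ l * dG x j k l"]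
          sum_swap3[of "\<lambda>j k l. u $ j * v $ k * w $ l * dG x k j l"]) (simp add: mult_ac)
  qed
  finally show "2 * metric_form G x (christoffel_form G x u v) w
      = frechet_derivative (\<lambda>y. metric_form G y v w) (at x) u + frechet_derivative (\<lambda>y. metric_form G y u w) (at x) v
        - frechet_derivative (\<lambda>y. metric_form G y u v) (at x) w"
    unfolding frechet_derivative_metric_form[OF x] .
qed

section \<open>Curvature components and their contractions\<close>

text \<open>For constant fields the terms with \<open>nabla G X Y\<close> as direction are symmetric
  by torsion-freeness and cancel in \<open>curvature\<close>.\<close>

lemma curv_mixed_eq:
  assumes x: "x \<in> S"
  shows "curv_mixed G x k l m i = R x (axis k 1) (axis l 1) (axis m 1) $ i"
proof -
  have nabla: "nabla G X Y y = frechet_derivative Y (at y) (X y) + christoffel_form G y (X y) (Y y)" for X Y y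
    by (simp add: nabla_def christoffel_form_def)
  have "curvature G (\<lambda>_. u) (\<lambda>_. v) (\<lambda>_. w) x = R x u v w" for u v w
    unfolding curvature_def nabla2_def nabla R_def d\<Gamma>_def
    by (simp add: \<Gamma>_sym[OF x, of v u])
  then show ?thesis by (simp add: curv_mixed_def)
qed

lemma curv_low_eq:
  assumes x: "x \<in> S"
  shows "curv_low G x i j k l = metric_form G x (R x (axis i 1) (axis j 1) (axis k 1)) (axis l 1)"
  by (simp add: curv_low_def curv_mixed_eq[OF x] metric_form_def matrix_vector_mult_basis column_def inner_vec_def)

lemma curv_up_pair_sym:
  assumes x: "x \<in> S"
  shows "curv_up G x i j k l = curv_up G x k l i j"
  unfolding curv_up_def curv_low_eq[OF x]
  by (subst sum.swap, subst R_pair_sym[OF x]) (simp add: mult_ac)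

text \<open>Row \<open>i\<close> of the inverse matrix is the metric dual of the \<open>i\<close>-th
  coordinate covector.\<close>

lemma inv_row_metric_form:
  assumes x: "x \<in> S"
  shows "metric_form G x (matrix_inv (G x) $ i) v = v $ i"
proof -
  have "metric_form G x (matrix_inv (G x) $ i) v = (matrix_inv (G x) *v (G x *v v)) $ i"
    by (simp add: metric_form_def inner_vec_def matrix_vector_mult_def[of "matrix_inv (G x)"])
  also have "\<dots> = v $ i"
    by (simp add: matrix_vector_mul_assoc matrix_inv_inverse[OF invertible_G[OF x]])
  finally show ?thesis .
qed

lemma vec_expansion: "(v :: real ^ 'n) = (\<Sum>i\<in>UNIV. v $ i *\<^sub>R axis i 1)"
  by (simp only: basis_expansion flip: scalar_mult_eq_scaleR)

text \<open>Raising the first index inserts a dual vector into the first slot. The third index is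
  first exchanged with the fourth by \<open>R_skew\<close>, whence the minus sign; raising it then
  reads off component \<open>k\<close> of the value.\<close>

lemma curv_up_eq:
  assumes x: "x \<in> S"
  shows "curv_up G x i j k l = - (R x (matrix_inv (G x) $ i) (axis j 1) (axis l 1)) $ k"
proof -
  let ?I = "matrix_inv (G x)"
  have "(\<Sum>b\<in>UNIV. ?I $ k $ b * metric_form G x (R x (axis a 1) (axis j 1) (axis b 1)) (axis l 1))
      = - R x (axis a 1) (axis j 1) (axis l 1) $ k" for a
  proof -
    have "(\<Sum>b\<in>UNIV. ?I $ k $ b * metric_form G x (R x (axis a 1) (axis j 1) (axis b 1)) (axis l 1))
        = - (\<Sum>b\<in>UNIV. ?I $ k $ b * metric_form G x (R x (axis a 1) (axis j 1) (axis l 1)) (axis b 1))"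
      by (subst R_skew[OF x]) (simp add: sum_negf)
    also have "(\<Sum>b\<in>UNIV. ?I $ k $ b * metric_form G x (R x (axis a 1) (axis j 1) (axis l 1)) (axis b 1))
        = metric_form G x (R x (axis a 1) (axis j 1) (axis l 1)) (\<Sum>b\<in>UNIV. ?I $ k $ b *\<^sub>R axis b 1)"
      by (simp add: linear_sum[OF linear_g(2)] linear_scale[OF linear_g(2)])
    also have "\<dots> = R x (axis a 1) (axis j 1) (axis l 1) $ k"
      unfolding vec_expansion[symmetric] by (subst g_sym[OF x]) (rule inv_row_metric_form[OF x])
    finally show ?thesis .
  qed
  then have "curv_up G x i j k l = - (\<Sum>a\<in>UNIV. ?I $ i $ a * R x (axis a 1) (axis j 1) (axis l 1) $ k)"
    by (simp add: curv_up_def curv_low_eq[OF x] mult.assoc sum_negf flip: sum_distrib_left)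
  also have "\<dots> = - R x (\<Sum>a\<in>UNIV. ?I $ i $ a *\<^sub>R axis a 1) (axis j 1) (axis l 1) $ k"
    by (simp add: linear_sum[OF linear_R(1)[OF x]] linear_scale[OF linear_R(1)[OF x]])
  finally show ?thesis unfolding vec_expansion[symmetric] .
qed

text \<open>\<open>U a a'\<close> is the matrix of a curvature endomorphism, and by the Ricci identity the tensor
  \<open>U\<close> is invariant under such endomorphisms.\<close>

lemma curv_up_invariant:
  assumes parallel: "\<And>y z u v w. y \<in> S \<Longrightarrow> nabla_R y z u v w = 0" and x: "x \<in> S"
  defines "U \<equiv> curv_up G x"
  shows "(\<Sum>d\<in>UNIV. U a a' b d * U d b' c c') - (\<Sum>d\<in>UNIV. U b d c c' * U a a' d b')
      + (\<Sum>d\<in>UNIV. U a a' c d * U b b' d c') - (\<Sum>d\<in>UNIV. U b b' c d * U a a' d c') = 0"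
proof -
  define I where "I i = matrix_inv (G x) $ i" for i
  define e where "e i = (axis i 1 :: real ^ 'n)" for i
  \<comment> \<open>The curvature endomorphism whose matrix is, up to sign,
    \<open>U a a'\<close>.\<close>
  define T where "T = R x (I a) (e a')"
  have U: "U i j k l = - R x (I i) (e j) (e l) $ k" for i j k l
    unfolding U_def I_def e_def by (rule curv_up_eq[OF x])
  have UT: "U a a' k l = - T (e l) $ k" for k l
    unfolding U T_def by (rule refl)
  have expand: "(\<Sum>d\<in>UNIV. v $ d *\<^sub>R e d) = v" for v
    unfolding e_def by (rule vec_expansion[symmetric])
  have linT: "linear T" unfolding T_def by (rule linear_R(3)[OF x])
  \<comment> \<open>\<open>T\<close> is skew for the metric, so its transpose on the raised index
    acts as \<open>- T\<close> on the dual vectors.\<close>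
  have raise: "(\<Sum>d\<in>UNIV. T (e d) $ b *\<^sub>R I d) = - T (I b)"
  proof (rule g_eqI[OF x])
    fix z
    have "metric_form G x (\<Sum>d\<in>UNIV. T (e d) $ b *\<^sub>R I d) z = (\<Sum>d\<in>UNIV. T (e d) $ b * z $ d)"
      by (simp add: linear_sum[OF linear_g(1)] linear_scale[OF linear_g(1)] I_def inv_row_metric_form[OF x])
    also have "\<dots> = T (\<Sum>d\<in>UNIV. z $ d *\<^sub>R e d) $ b"
      by (simp add: linear_sum[OF linT] linear_scale[OF linT] mult.commute)
    also have "\<dots> = metric_form G x (I b) (T z)" by (simp add: expand I_def inv_row_metric_form[OF x])
    also have "\<dots> = - metric_form G x (T (I b)) z"
      unfolding T_def by (subst g_sym[OF x], subst R_skew[OF x]) (simp add: g_sym[OF x])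
    finally show "metric_form G x (\<Sum>d\<in>UNIV. T (e d) $ b *\<^sub>R I d) z = metric_form G x (- T (I b)) z"
      by (simp add: g_simps)
  qed
  have 1: "(\<Sum>d\<in>UNIV. U a a' b d * U d b' c c') = - R x (T (I b)) (e b') (e c') $ c"
  proof -
    have "(\<Sum>d\<in>UNIV. U a a' b d * U d b' c c') = R x (\<Sum>d\<in>UNIV. T (e d) $ b *\<^sub>R I d) (e b') (e c') $ c"
      unfolding UT unfolding U by (simp add: linear_sum[OF linear_R(1)[OF x]] linear_scale[OF linear_R(1)[OF x]])
    then show ?thesis by (simp add: raise R_simps[OF x])
  qed
  have 2: "(\<Sum>d\<in>UNIV. U b d c c' * U a a' d b') = R x (I b) (T (e b')) (e c') $ c"
  proof -
    have "(\<Sum>d\<in>UNIV. U b d c c' * U a a' d b') = R x (I b) (\<Sum>d\<in>UNIV. T (e b') $ d *\<^sub>R e d) (e c') $ c"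
      unfolding UT unfolding U by (simp add: linear_sum[OF linear_R(2)[OF x]] linear_scale[OF linear_R(2)[OF x]] mult.commute)
    then show ?thesis by (simp add: expand)
  qed
  have 3: "(\<Sum>d\<in>UNIV. U a a' c d * U b b' d c') = T (R x (I b) (e b') (e c')) $ c"
  proof -
    have "(\<Sum>d\<in>UNIV. U a a' c d * U b b' d c') = T (\<Sum>d\<in>UNIV. R x (I b) (e b') (e c') $ d *\<^sub>R e d) $ c"
      unfolding UT unfolding U by (simp add: linear_sum[OF linT] linear_scale[OF linT] mult.commute)
    then show ?thesis by (simp add: expand)
  qed
  have 4: "(\<Sum>d\<in>UNIV. U b b' c d * U a a' d c') = R x (I b) (e b') (T (e c')) $ c"
  proof -
    have "(\<Sum>d\<in>UNIV. U b b' c d * U a a' d c') = R x (I b) (e b') (\<Sum>d\<in>UNIV. T (e c') $ d *\<^sub>R e d) $ c"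
      unfolding UT unfolding U by (simp add: linear_sum[OF linear_R(3)[OF x]] linear_scale[OF linear_R(3)[OF x]] mult.commute)
    then show ?thesis by (simp add: expand)
  qed
  \<comment> \<open>The four sums are \<open>T\<close> acting on the three arguments and on the
    value of \<open>R\<close>; their signed sum is component \<open>c\<close> of the Ricci
    identity.\<close>
  show ?thesis
    unfolding 1 2 3 4
    using arg_cong[OF ricci[OF parallel x, of "I a" "e a'" "I b" "e b'" "e c'"], of "\<lambda>v. v $ c"]
    by (simp add: T_def)
qed

end

subsection \<open>The classical Yang-Baxter equation\<close>

lemma sum_triple:
  "(\<Sum>I\<in>(UNIV :: ('n::finite \<times> 'n \<times> 'n) set). f I) = (\<Sum>d\<in>UNIV. \<Sum>e\<in>UNIV. \<Sum>h\<in>UNIV. f (d, e, h))"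
  by (simp add: sum.cartesian_product UNIV_Times_UNIV split_def)

lemma sum_if_const: "(\<Sum>i\<in>I. if Q then f i else 0) = (if Q then \<Sum>i\<in>I. f i else 0)"
  by simp

text \<open>The Kronecker deltas of the identity factors collapse two of the three sums; what
  remains is the contraction over the factor that both legs share.\<close>

lemma leg_products:
  fixes X Y :: "'k::field ^ ('n::finite \<times> 'n) ^ ('n \<times> 'n)"
  shows "(leg12 X ** leg13 Y) $ (a, b, c) $ (a', b', c') = (\<Sum>d\<in>UNIV. X $ (a, b) $ (d, b') * Y $ (d, c) $ (a', c'))"
    and "(leg13 Y ** leg12 X) $ (a, b, c) $ (a', b', c') = (\<Sum>d\<in>UNIV. Y $ (a, c) $ (d, c') * X $ (d, b) $ (a', b'))"
    and "(leg12 X ** leg23 Y) $ (a, b, c) $ (a', b', c') = (\<Sum>d\<in>UNIV. X $ (a, b) $ (a', d) * Y $ (d, c) $ (b', c'))"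
    and "(leg23 Y ** leg12 X) $ (a, b, c) $ (a', b', c') = (\<Sum>d\<in>UNIV. Y $ (b, c) $ (d, c') * X $ (a, d) $ (a', b'))"
    and "(leg13 X ** leg23 Y) $ (a, b, c) $ (a', b', c') = (\<Sum>d\<in>UNIV. X $ (a, c) $ (a', d) * Y $ (b, d) $ (b', c'))"
    and "(leg23 Y ** leg13 X) $ (a, b, c) $ (a', b', c') = (\<Sum>d\<in>UNIV. Y $ (b, c) $ (b', d) * X $ (a, d) $ (a', c'))"
  by (simp_all add: matrix_matrix_mult_def leg12_def leg13_def leg23_def sum_triple sum_if_const
      if_distrib[of "\<lambda>t. t * _"] if_distrib[of "\<lambda>t. _ * t"] sum.delta sum.delta' cong: if_cong)

text \<open>The hypotheses say that \<open>t = (K a a' b b')\<close> satisfies \<open>[t\<^sub>1\<^sub>2, t\<^sub>1\<^sub>3 + t\<^sub>2\<^sub>3] = 0\<close> and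
  \<open>[t\<^sub>1\<^sub>2 + t\<^sub>1\<^sub>3, t\<^sub>2\<^sub>3] = 0\<close>; hence the three commutators agree up to sign, and the sum of
  their coefficients vanishes.\<close>

lemma cybe_of_infinitesimal_braid:
  fixes K :: "'n::finite \<Rightarrow> 'n \<Rightarrow> 'n \<Rightarrow> 'n \<Rightarrow> 'k::field" and l1 l2 l3 :: 'k
  assumes braid1: "\<And>a a' b b' c c'.
      (\<Sum>d\<in>UNIV. K a d b b' * K d a' c c') - (\<Sum>d\<in>UNIV. K a d c c' * K d a' b b')
      + (\<Sum>d\<in>UNIV. K a a' b d * K d b' c c') - (\<Sum>d\<in>UNIV. K b d c c' * K a a' d b') = 0"
    and braid2: "\<And>a a' b b' c c'.
      (\<Sum>d\<in>UNIV. K a a' b d * K d b' c c') - (\<Sum>d\<in>UNIV. K b d c c' * K a a' d b')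
      + (\<Sum>d\<in>UNIV. K a a' c d * K b b' d c') - (\<Sum>d\<in>UNIV. K b b' c d * K a a' d c') = 0"
    and r: "\<And>\<mu> \<nu> a a' b b'. r \<mu> \<nu> $ (a, b) $ (a', b') = 1 / (\<mu> - \<nu>) * K a a' b b'"
    and neq: "l1 \<noteq> l2" "l1 \<noteq> l3" "l2 \<noteq> l3"
  shows "commutator (leg12 (r l1 l2)) (leg13 (r l1 l3)) + commutator (leg12 (r l1 l2)) (leg23 (r l2 l3))
    + commutator (leg13 (r l1 l3)) (leg23 (r l2 l3)) = 0"
proof -
  have "(commutator (leg12 (r l1 l2)) (leg13 (r l1 l3)) + commutator (leg12 (r l1 l2)) (leg23 (r l2 l3))
    + commutator (leg13 (r l1 l3)) (leg23 (r l2 l3))) $ (a, b, c) $ (a', b', c') = 0" for a b c a' b' c'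
  proof -
    define p where "p = 1 / (l1 - l2)"
    define q where "q = 1 / (l1 - l3)"
    define s where "s = 1 / (l2 - l3)"
    \<comment> \<open>The partial fraction identity; over the common denominator the numerators are
      \<open>l2 - l3\<close>, \<open>- (l1 - l3)\<close> and \<open>l1 - l2\<close>.\<close>
    have pqs: "p * q - p * s + q * s = 0"
      using neq by (simp add: p_def q_def s_def divide_simps)
    \<comment> \<open>\<open>A1 - A2\<close>, \<open>B1 - B2\<close> and \<open>C1 - C2\<close> are
      the entries of the commutators of \<open>t\<close> on the legs 12 and 13, 12 and 23, and 13
      and 23.\<close>
    define A1 where "A1 = (\<Sum>d\<in>UNIV. K a d b b' * K d a' c c')"
    define A2 where "A2 = (\<Sum>d\<in>UNIV. K a d c c' * K d a' b b')"
    define B1 where "B1 = (\<Sum>d\<in>UNIV. K a a' b d * K d b' c c')"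
    define B2 where "B2 = (\<Sum>d\<in>UNIV. K b d c c' * K a a' d b')"
    define C1 where "C1 = (\<Sum>d\<in>UNIV. K a a' c d * K b b' d c')"
    define C2 where "C2 = (\<Sum>d\<in>UNIV. K b b' c d * K a a' d c')"
    have pull: "(\<Sum>d\<in>UNIV. x * f d * (y * h d)) = x * y * (\<Sum>d\<in>UNIV. f d * h d)"
      for x y and f h :: "'n \<Rightarrow> 'k"
      by (simp add: sum_distrib_left mult_ac)
    have "(commutator (leg12 (r l1 l2)) (leg13 (r l1 l3)) + commutator (leg12 (r l1 l2)) (leg23 (r l2 l3))
      + commutator (leg13 (r l1 l3)) (leg23 (r l2 l3))) $ (a, b, c) $ (a', b', c')
      = p * q * (A1 - A2) + p * s * (B1 - B2) + q * s * (C1 - C2)"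
      unfolding commutator_def plus_vec_def minus_vec_def
      by (simp add: leg_products r pull A1_def A2_def B1_def B2_def C1_def C2_def
          flip: p_def q_def s_def) (simp add: algebra_simps)
    also have "\<dots> = (A1 - A2) * (p * q - p * s + q * s)"
    proof -
      have "B1 - B2 = - (A1 - A2)"
        using braid1[of a b b' a' c c'] by (simp add: A1_def A2_def B1_def B2_def algebra_simps eq_neg_iff_add_eq_0)
      moreover have "C1 - C2 = - (B1 - B2)"
        using braid2[of a a' b b' c c'] by (simp add: C1_def C2_def B1_def B2_def algebra_simps eq_neg_iff_add_eq_0)
      ultimately have "B1 - B2 = - (A1 - A2)" "C1 - C2 = A1 - A2" by simp_all
      then show ?thesis by (simp only:) (simp add: algebra_simps)
    qed
    finally show ?thesis by (simp add: pqs)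
  qed
  then show ?thesis by (simp add: vec_eq_iff)
qed

section \<open>Constants and spectral parameters in the field of rational functions\<close>

lemma const_rf_hom:
  "const_rf (x + y) = const_rf x + const_rf y"
  "const_rf (x - y) = const_rf x - const_rf y"
  "const_rf (x * y) = const_rf x * const_rf y"
  "const_rf 0 = 0"
  by (simp_all add: const_rf_def Fraction_Field.Zero_fract_def mult.commute)

lemma const_rf_sum: "const_rf (\<Sum>i\<in>I. f i) = (\<Sum>i\<in>I. const_rf (f i))"
  by (induction I rule: infinite_finite_induct) (simp_all add: const_rf_hom)

text \<open>Ensures that the coefficients in \<open>r_hat\<close> are genuine fractions, as division
  by zero would yield 0.\<close>

lemma lam_distinct: "lam1 \<noteq> lam2" "lam1 \<noteq> lam3" "lam2 \<noteq> lam3"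
  by (simp_all add: lam1_def lam2_def lam3_def Fraction_Field.eq_fract)

text \<open>Each summand is a multiple of a matrix unit, so the entry selects the single index tuple
  with \<open>i = a\<close>, \<open>j = a'\<close>, \<open>k = b\<close>,
  \<open>l = b'\<close>.\<close>

lemma r_hat_entry:
  "r_hat G x \<mu> \<nu> $ (a, b) $ (a', b') = 1 / (\<mu> - \<nu>) * const_rf (curv_up G x a a' b b')"
proof -
  \<comment> \<open>Nested conditionals let the delta rules for sums act on one index at a
    time.\<close>
  have conj: "(if Q \<and> Q' then 1 else 0 :: ratfun3) = (if Q then if Q' then 1 else 0 else 0)" for Q Q' by simp
  show ?thesis
    by (simp add: r_hat_def scale_mat_def tensor_def elem_end_def conj sum_if_const
        if_distrib[of "\<lambda>t. t * _"] if_distrib[of "\<lambda>t. _ * t"] cong: if_cong)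
qed

subsection \<open>Locally symmetric spaces\<close>

lemma semi_riemannian_domain_chart:
  assumes "semi_riemannian_manifold A g" "c \<in> A"
  shows "semi_riemannian_domain (ran_ch c) (g c)"
proof
  show "open (ran_ch c)"
    using assms by (auto simp: semi_riemannian_manifold_def smooth_structure_def is_chart_def)
  show "smooth_on (ran_ch c) (\<lambda>x. g c x $ i $ j)" for i j
    using assms by (simp add: semi_riemannian_manifold_def)
  show "v \<bullet> (g c x *v w) = w \<bullet> (g c x *v v)" if "x \<in> ran_ch c" for x v w
    using assms that unfolding semi_riemannian_manifold_def by blast
  show "v = 0" if "x \<in> ran_ch c" "\<And>w. v \<bullet> (g c x *v w) = 0" for x v
    using assms that unfolding semi_riemannian_manifold_def by blast
qed

lemma param_coord:
  assumes "is_chart c" "q \<in> dom_ch c"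
  shows "param c (coord c q) = q"
  using assms unfolding is_chart_def homeomorphism_def by blast

lemma coord_param:
  assumes "is_chart c" "x \<in> ran_ch c"
  shows "coord c (param c x) = x" "param c x \<in> dom_ch c"
  using assms unfolding is_chart_def homeomorphism_def by blast+

lemma open_coord_image:
  assumes "is_chart c" "open U" "U \<subseteq> dom_ch c"
  shows "open (coord c ` U)"
proof -
  have hom: "homeomorphism (dom_ch c) (ran_ch c) (coord c) (param c)" and ran: "open (ran_ch c)"
    using assms(1) by (auto simp: is_chart_def)
  have "openin (top_of_set (dom_ch c)) U" using assms(2,3) by (simp add: open_subset)
  from homeomorphism_imp_open_map[OF hom this] show ?thesis using ran by (metis openin_open_trans)
qed

text \<open>In the chart \<open>d\<close> the geodesic symmetry reads \<open>uminus\<close>, as does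
  its derivative, and the two signs in the isometry condition cancel by bilinearity.\<close>

lemma metric_even_in_exponential_chart:
  assumes "is_chart d" "d \<in> A" "uminus ` ran_ch d = ran_ch d"
    and iso: "isometric_on A g (dom_ch d) (geodesic_symmetry d)" and y: "y \<in> ran_ch d"
  shows "metric_form (g d) (- y) u v = metric_form (g d) y u v"
proof -
  let ?f = "geodesic_symmetry d"
  have sym: "coord d (?f (param d z)) = - z" "?f (param d z) \<in> dom_ch d" if "z \<in> ran_ch d" for z
  proof -
    have "- z \<in> ran_ch d" using that assms(3) by blast
    then show "coord d (?f (param d z)) = - z" "?f (param d z) \<in> dom_ch d"
      by (simp_all add: geodesic_symmetry_def coord_param[OF assms(1)] that)
  qed
  have der: "(uminus has_derivative uminus) (at y)"
    by (rule has_derivative_minus[OF has_derivative_ident])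
  \<comment> \<open>The coordinate expression agrees with \<open>uminus\<close> on the range of the
    chart only; openness of the range makes the derivatives equal.\<close>
  have "frechet_derivative uminus (at y) = frechet_derivative (coord d \<circ> ?f \<circ> param d) (at y)"
    using y assms(1) sym
    by (intro frechet_derivative_transform_within_open[where X="ran_ch d"] differentiableI[OF der])
      (auto simp: is_chart_def)
  then have T: "frechet_derivative (coord d \<circ> ?f \<circ> param d) (at y) = uminus"
    using frechet_derivative_at[OF der] by simp
  have "param d y \<in> dom_ch d \<inter> dom_ch d \<inter> ?f -` dom_ch d"
    using coord_param(2)[OF assms(1) y] sym(2)[OF y] by simp
  then have "let T = frechet_derivative (coord d \<circ> ?f \<circ> param d) (at (coord d (param d y)))
      in T u \<bullet> (g d (coord d (?f (param d y))) *v T v) = u \<bullet> (g d (coord d (param d y)) *v v)"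
    using iso assms(2) unfolding isometric_on_def by blast
  then show ?thesis
    unfolding coord_param(1)[OF assms(1) y] Let_def T sym(1)[OF y] metric_form_def[symmetric]
    by (simp add: bilinear_lneg[OF bilinear_metric_form] bilinear_rneg[OF bilinear_metric_form])
qed

text \<open>The transformation law required of the metric says that transition maps preserve
  it.\<close>

lemma local_isometry_transition:
  assumes M: "semi_riemannian_manifold A g" and c: "c \<in> A" and d: "d \<in> A"
  shows "local_isometry (ran_ch c) (metric_form (g c)) (christoffel_form (g c))
    (ran_ch d) (metric_form (g d)) (christoffel_form (g d))
    (coord c ` (dom_ch c \<inter> dom_ch d)) (coord d \<circ> param c)"
proof -
  interpret C: semi_riemannian_domain "ran_ch c" "g c" by (rule semi_riemannian_domain_chart[OF M c])
  interpret D: semi_riemannian_domain "ran_ch d" "g d" by (rule semi_riemannian_domain_chart[OF M d])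
  have ch: "is_chart c" "is_chart d" and comp: "compatible c d"
    using M c d by (auto simp: semi_riemannian_manifold_def smooth_structure_def)
  show ?thesis
  proof
    show "open (coord c ` (dom_ch c \<inter> dom_ch d))"
      using ch by (intro open_coord_image) (auto simp: is_chart_def)
    show "coord c ` (dom_ch c \<inter> dom_ch d) \<subseteq> ran_ch c" by (auto simp: ran_ch_def)
    show "(coord d \<circ> param c) ` coord c ` (dom_ch c \<inter> dom_ch d) \<subseteq> ran_ch d"
      by (auto simp: param_coord[OF ch(1)] ran_ch_def)
    show "smooth_on (coord c ` (dom_ch c \<inter> dom_ch d)) (coord d \<circ> param c)"
      using comp by (simp add: compatible_def)
    fix x u v
    assume "x \<in> coord c ` (dom_ch c \<inter> dom_ch d)"
    then obtain q where q: "q \<in> dom_ch c \<inter> dom_ch d" "x = coord c q" by blast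
    have "let T = frechet_derivative (coord d \<circ> param c) (at (coord c q))
        in T u \<bullet> (g d (coord d q) *v T v) = u \<bullet> (g c (coord c q) *v v)"
      using M c d q(1) unfolding semi_riemannian_manifold_def by blast
    then show "metric_form (g d) ((coord d \<circ> param c) x) (frechet_derivative (coord d \<circ> param c) (at x) u)
        (frechet_derivative (coord d \<circ> param c) (at x) v) = metric_form (g c) x u v"
      using q by (simp add: Let_def metric_form_def param_coord[OF ch(1)])
  qed
qed

text \<open>Each point is treated with an exponential chart centred at it, so the vanishing holds on
  the whole range of \<open>c\<close> and may be differentiated there.\<close>

lemma nabla_R_eq_0:
  assumes M: "semi_riemannian_manifold A g" and ls: "locally_symmetric A g" and c: "c \<in> A"
    and x: "x \<in> ran_ch c"
  shows "metric_chart.nabla_R (christoffel_form (g c)) x z u v w = 0"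
proof -
  obtain q where q: "q \<in> dom_ch c" "x = coord c q" using x by (auto simp: ran_ch_def)
  \<comment> \<open>The chart is centred at the point \<open>q\<close> with coordinates
    \<open>x\<close>, so the transition map sends \<open>x\<close> to 0, where
    \<open>even_metric\<close> applies.\<close>
  obtain d where d: "exponential_chart A g q d" "uminus ` ran_ch d = ran_ch d"
      "isometric_on A g (dom_ch d) (geodesic_symmetry d)"
    using ls unfolding locally_symmetric_def by blast
  have dA: "d \<in> A" and qd: "q \<in> dom_ch d" "coord d q = 0"
    using d(1) by (auto simp: exponential_chart_def)
  have ch: "is_chart c" "is_chart d"
    using M c dA by (auto simp: semi_riemannian_manifold_def smooth_structure_def)
  interpret local_isometry "ran_ch c" "metric_form (g c)" "christoffel_form (g c)"
    "ran_ch d" "metric_form (g d)" "christoffel_form (g d)"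
    "coord c ` (dom_ch c \<inter> dom_ch d)" "coord d \<circ> param c"
    by (rule local_isometry_transition[OF M c dA])
  have "0 \<in> ran_ch d" using qd unfolding ran_ch_def by force
  note even = B.even_metric[OF this d(2) metric_even_in_exponential_chart[OF ch(2) dA d(2,3)]]
  show ?thesis
    by (rule nabla_R_pullback_0) (use q qd even in \<open>auto simp: param_coord[OF ch(1)]\<close>)
qed

theorem theorem2p1:
  fixes A :: "('m::{t2_space,second_countable_topology}, 'n::finite) chart set"
    and g :: "('m, 'n) metric"
    and c :: "('m, 'n) chart"
    and p :: 'm
  assumes "semi_riemannian_manifold A g"
    and "locally_symmetric A g"
    and "c \<in> A" and "p \<in> dom_ch c"
  shows "commutator (leg12 (r_hat (g c) (coord c p) lam1 lam2)) (leg13 (r_hat (g c) (coord c p) lam1 lam3))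
       + commutator (leg12 (r_hat (g c) (coord c p) lam1 lam2)) (leg23 (r_hat (g c) (coord c p) lam2 lam3))
       + commutator (leg13 (r_hat (g c) (coord c p) lam1 lam3)) (leg23 (r_hat (g c) (coord c p) lam2 lam3)) = 0"
proof -
  interpret semi_riemannian_domain "ran_ch c" "g c"
    by (rule semi_riemannian_domain_chart[OF assms(1,3)])
  define U where "U = curv_up (g c) (coord c p)"
  have x: "coord c p \<in> ran_ch c" using assms(4) by (simp add: ran_ch_def)
  have pair: "U i j k l = U k l i j" for i j k l
    unfolding U_def by (rule curv_up_pair_sym[OF x])
  have invariant: "(\<Sum>d\<in>UNIV. U a a' b d * U d b' c c') - (\<Sum>d\<in>UNIV. U b d c c' * U a a' d b')
      + (\<Sum>d\<in>UNIV. U a a' c d * U b b' d c') - (\<Sum>d\<in>UNIV. U b b' c d * U a a' d c') = 0"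
    for a a' b b' c c'
    unfolding U_def by (rule curv_up_invariant[OF nabla_R_eq_0[OF assms(1-3)] x])
  show ?thesis
  proof (rule cybe_of_infinitesimal_braid[where K="\<lambda>i j k l. const_rf (U i j k l)"])
    show "r_hat (g c) (coord c p) \<mu> \<nu> $ (a, b) $ (a', b') = 1 / (\<mu> - \<nu>) * const_rf (U a a' b b')"
      for \<mu> \<nu> a a' b b'
      unfolding U_def by (rule r_hat_entry)
    show "(\<Sum>d\<in>UNIV. const_rf (U a a' b d) * const_rf (U d b' c c'))
      - (\<Sum>d\<in>UNIV. const_rf (U b d c c') * const_rf (U a a' d b'))
      + (\<Sum>d\<in>UNIV. const_rf (U a a' c d) * const_rf (U b b' d c'))
      - (\<Sum>d\<in>UNIV. const_rf (U b b' c d) * const_rf (U a a' d c')) = 0" for a a' b b' c c'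
      using arg_cong[OF invariant[of a a' b b' c c'], of const_rf] by (simp only: const_rf_hom const_rf_sum)
    \<comment> \<open>By pair symmetry the third tensor factor also consists of curvature
      endomorphisms; this is \<open>invariant\<close> with the third factor acting on the first
      two.\<close>
    have "(\<Sum>d\<in>UNIV. U a d b b' * U d a' c c') - (\<Sum>d\<in>UNIV. U a d c c' * U d a' b b')
      + (\<Sum>d\<in>UNIV. U a a' b d * U d b' c c') - (\<Sum>d\<in>UNIV. U b d c c' * U a a' d b') = 0"
      for a a' b b' c c'
    proof -
      have "(\<Sum>d\<in>UNIV. U a d b b' * U d a' c c') = (\<Sum>d\<in>UNIV. U c c' d a' * U a d b b')"
        "(\<Sum>d\<in>UNIV. U a d c c' * U d a' b b') = (\<Sum>d\<in>UNIV. U c c' a d * U d a' b b')"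
        "(\<Sum>d\<in>UNIV. U a a' b d * U d b' c c') = (\<Sum>d\<in>UNIV. U a a' b d * U c c' d b')"
        "(\<Sum>d\<in>UNIV. U b d c c' * U a a' d b') = (\<Sum>d\<in>UNIV. U c c' b d * U a a' d b')"
        by (simp_all add: pair[of _ _ c c'] mult.commute)
      then show ?thesis using invariant[of c c' a a' b b'] by (simp add: mult.commute)
    qed
    from arg_cong[OF this, of const_rf]
    show "(\<Sum>d\<in>UNIV. const_rf (U a d b b') * const_rf (U d a' c c'))
      - (\<Sum>d\<in>UNIV. const_rf (U a d c c') * const_rf (U d a' b b'))
      + (\<Sum>d\<in>UNIV. const_rf (U a a' b d) * const_rf (U d b' c c'))
      - (\<Sum>d\<in>UNIV. const_rf (U b d c c') * const_rf (U a a' d b')) = 0" for a a' b b' c c'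
      by (simp only: const_rf_hom const_rf_sum)
  qed (rule lam_distinct)+
qed

end
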